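(* Let $k$ be real with $0<k<4$, and put $a=\sqrt{(4+k)/(4-k)}$ and $c=k/\sqrt{4-k}$. Then $$\mathrm{m}(P_{1,k})=\mathrm{m}^-(P_{a,c})-3\,\mathrm{m}^+(P_{a,c}).$$
   Context: For a nonzero Laurent polynomial $P\in\mathbb{C}[x^{\pm1},y^{\pm1}]$, the (logarithmic) Mahler measure is $$\mathrm{m}(P)=\int_0^1\int_0^1\log|P(e^{2\pi i\theta_1},e^{2\pi i\theta_2})|\,\mathrm{d}\theta_1\,\mathrm{d}\theta_2 .$$ For real $a,c$ set $$P_{a,c}(x,y)=a\Bigl(x+\frac1x\Bigr)+\Bigl(y+\frac1y\Bigr)+c,$$ so that $yP_{a,c}(x,y)=(y-y_+(x))(y-y_-(x))$ with $$y_\pm(x)=\frac{-(a(x+x^{-1})+c)\pm\sqrt{(a(x+x^{-1})+c)^2-4}}{2}.$$ For $|x|=1$ the quantity $a(x+x^{-1})+c$ is real; the square root is the nonnegative one when $(a(x+x^{-1})+c)^2\ge4$, and otherwise $|y_+(x)|=|y_-(x)|=1$ for either choice of the root. The "half-Mahler" measures are $$\mathrm{m}^{\pm}(P_{a,c})=\frac1{2\pi i}\int_{|x|=1}\log^+|y_\pm(x)|\,\frac{\mathrm{d}x}{x},\qquad \log^+ t=\max\{0,\log t\}.$$ *)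

theory Defs
  imports "HOL-Complex_Analysis.Complex_Analysis" "HOL-Library.Poly_Mapping"
begin

text \<open>
  A Laurent polynomial in \<open>\<complex>[x\<^sup>\<plusminus>\<^sup>1, y\<^sup>\<plusminus>\<^sup>1]\<close> is a finitely supported map that sends the
  exponent pair \<open>(i, j)\<close> to the coefficient of \<open>x\<^sup>i y\<^sup>j\<close>.
\<close>

type_synonym laurent2 = "(int \<times> int) \<Rightarrow>\<^sub>0 complex"

definition laurent2_eval :: "laurent2 \<Rightarrow> complex \<Rightarrow> complex \<Rightarrow> complex" where
  "laurent2_eval P x y =
     (\<Sum>ij\<in>Poly_Mapping.keys P. Poly_Mapping.lookup P ij * x powi (fst ij) * y powi (snd ij))"

text \<open>
  For nonzero \<open>P\<close> the convention \<open>ln 0 = 0\<close> matters only on the zero locus of \<open>P\<close> on the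
  torus, which is a null set.
\<close>

definition mahler_measure :: "laurent2 \<Rightarrow> real" where
  "mahler_measure P =
     (LBINT \<theta>\<^sub>2=0..1. (LBINT \<theta>\<^sub>1=0..1.
        ln (cmod (laurent2_eval P (exp (2 * of_real pi * \<i> * of_real \<theta>\<^sub>1))
                                  (exp (2 * of_real pi * \<i> * of_real \<theta>\<^sub>2))))))"

definition P_poly :: "real \<Rightarrow> real \<Rightarrow> laurent2" where
  "P_poly a c =
     Poly_Mapping.single (1, 0) (of_real a) + Poly_Mapping.single (-1, 0) (of_real a)
     + Poly_Mapping.single (0, 1) 1 + Poly_Mapping.single (0, -1) 1
     + Poly_Mapping.single (0, 0) (of_real c)"

text \<open>
  For \<open>|x| = 1\<close> the radicand is real, and \<open>csqrt\<close> of a nonnegative real is its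
  nonnegative square root. Where the radicand is negative, both \<open>y_plus\<close> and
  \<open>y_minus\<close> have modulus 1, so the choice of root does not matter there.
\<close>

definition y_plus :: "real \<Rightarrow> real \<Rightarrow> complex \<Rightarrow> complex" where
  "y_plus a c x =
     (- (of_real a * (x + 1 / x) + of_real c)
      + csqrt ((of_real a * (x + 1 / x) + of_real c)\<^sup>2 - 4)) / 2"

definition y_minus :: "real \<Rightarrow> real \<Rightarrow> complex \<Rightarrow> complex" where
  "y_minus a c x =
     (- (of_real a * (x + 1 / x) + of_real c)
      - csqrt ((of_real a * (x + 1 / x) + of_real c)\<^sup>2 - 4)) / 2"

definition log_plus :: "real \<Rightarrow> real" where
  "log_plus t = max 0 (ln t)"

text \<open>
  The half-Mahler measures are contour integrals, hence of type \<^typ>\<open>complex\<close>; their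
  values are real.
\<close>

definition half_mahler_plus :: "real \<Rightarrow> real \<Rightarrow> complex" where
  "half_mahler_plus a c =
     1 / (2 * of_real pi * \<i>) *
     contour_integral (circlepath 0 1) (\<lambda>x. of_real (log_plus (cmod (y_plus a c x))) / x)"

definition half_mahler_minus :: "real \<Rightarrow> real \<Rightarrow> complex" where
  "half_mahler_minus a c =
     1 / (2 * of_real pi * \<i>) *
     contour_integral (circlepath 0 1) (\<lambda>x. of_real (log_plus (cmod (y_minus a c x))) / x)"

lemma laurent2_eval_superset:
  assumes "finite A" "Poly_Mapping.keys P \<subseteq> A"
  shows "laurent2_eval P x y =
           (\<Sum>ij\<in>A. Poly_Mapping.lookup P ij * x powi (fst ij) * y powi (snd ij))"
  unfolding laurent2_eval_def
  by (rule sum.mono_neutral_left) (use assms in \<open>auto simp: in_keys_iff\<close>)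

lemma laurent2_eval_add:
  "laurent2_eval (P + Q) x y = laurent2_eval P x y + laurent2_eval Q x y"
proof -
  let ?A = "Poly_Mapping.keys P \<union> Poly_Mapping.keys Q"
  have fin: "finite ?A" by simp
  have sub: "Poly_Mapping.keys (P + Q) \<subseteq> ?A" by (rule keys_add)
  show ?thesis
    by (simp add: laurent2_eval_superset[OF fin sub] laurent2_eval_superset[OF fin Un_upper1]
        laurent2_eval_superset[OF fin Un_upper2] lookup_add ring_distribs sum.distrib)
qed

lemma laurent2_eval_single:
  "laurent2_eval (Poly_Mapping.single ij z) x y = z * x powi (fst ij) * y powi (snd ij)"
  by (simp add: laurent2_eval_def)

lemma laurent2_eval_P_poly:
  "laurent2_eval (P_poly a c) x y = of_real a * (x + 1 / x) + (y + 1 / y) + of_real c"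
  by (simp add: P_poly_def laurent2_eval_add laurent2_eval_single power_int_minus
      field_simps)

lemma P_poly_factorization:
  assumes "y \<noteq> 0"
  shows "y * laurent2_eval (P_poly a c) x y = (y - y_plus a c x) * (y - y_minus a c x)"
proof -
  define t where "t = of_real a * (x + 1 / x) + of_real c"
  define s where "s = csqrt (t\<^sup>2 - 4)"
  have s: "s\<^sup>2 = t\<^sup>2 - 4" by (simp add: s_def)
  have "(y - y_plus a c x) * (y - y_minus a c x) = (y - (- t + s) / 2) * (y - (- t - s) / 2)"
    by (simp add: y_plus_def y_minus_def t_def s_def)
  also have "\<dots> = y\<^sup>2 + t * y + (t\<^sup>2 - s\<^sup>2) / 4"
    by (simp add: field_simps power2_eq_square)
  also have "\<dots> = y\<^sup>2 + t * y + 1"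
    by (simp add: s)
  also have "\<dots> = y * (t + (y + 1 / y))"
    using assms by (simp add: field_simps power2_eq_square)
  finally show ?thesis
    by (simp add: laurent2_eval_P_poly t_def algebra_simps)
qed

end

theory Submission imports Defs begin

text \<open>
  Write \<open>H(b, c)\<close> for the mean of \<open>arcosh\<^sup>+ (b cos t + c)\<close> over the circle. Jensen's formula gives
  \<open>m(P\<^bsub>1,k\<^esub>) = H(1, k/2)\<close> and \<open>m\<^sup>\<minus>(P\<^bsub>a,c\<^esub>) = H(a, c/2)\<close>, \<open>m\<^sup>+(P\<^bsub>a,c\<^esub>) = H(a, -c/2)\<close>. All
  three vanish at \<open>k = 0\<close>, so by Tonelli it is enough to compare their \<open>k\<close>-derivatives, which are
  complete elliptic integrals in \<open>u = cos t\<close> over the band where the argument of \<open>arcosh\<close>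
  exceeds \<open>1\<close>. The derivative of \<open>m(P\<^bsub>1,k\<^esub>)\<close> is of the first kind; a Landen substitution and a
  Moebius map relate it to the integrals of the first kind belonging to \<open>P\<^bsub>a,c\<^esub>\<close>. The remaining
  parts of the other two are integrals of the third kind with the same integrand. It is elementary
  because the two points at infinity of the elliptic curve differ by a point of order 4: a quartic
  polynomial solves a Pell equation over the radicand and runs three times through \<open>[-1, 1]\<close> on one
  band, once on the other. Hence these parts are in the ratio 3:1 and cancel in \<open>m\<^sup>\<minus> - 3 m\<^sup>+\<close>.
\<close>

section \<open>Integrals over an interval\<close>

text \<open>Values in \<open>ennreal\<close> keep additivity and Tonelli free of integrability
  conditions, although the integrands are mostly singular at the ends. In exchange
  \<open>ennreal\<close> cuts negative values to 0, so sums and antiderivatives require nonnegative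
  integrands.\<close>

definition band_integral :: "real \<Rightarrow> real \<Rightarrow> (real \<Rightarrow> real) \<Rightarrow> ennreal" where
  "band_integral a b f = (\<integral>\<^sup>+u. ennreal (f u) * indicator {a..b} u \<partial>lborel)"

lemma band_integral_cong:
  assumes "\<And>u. a < u \<Longrightarrow> u < b \<Longrightarrow> f u = g u"
  shows "band_integral a b f = band_integral a b g"
  unfolding band_integral_def
proof (rule nn_integral_cong_AE)
  show "AE u in lborel. ennreal (f u) * indicator {a..b} u = ennreal (g u) * indicator {a..b} u"
    using AE_lborel_singleton[of a] AE_lborel_singleton[of b]
    by eventually_elim (use assms in \<open>auto simp: indicator_def\<close>)
qed

lemma band_integral_split:
  assumes [measurable]: "f \<in> borel_measurable borel" and "a \<le> b" "b \<le> c"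
  shows "band_integral a c f = band_integral a b f + band_integral b c f"
proof -
  have "band_integral a c f =
      (\<integral>\<^sup>+u. ennreal (f u) * indicator {a..b} u + ennreal (f u) * indicator {b..c} u \<partial>lborel)"
    unfolding band_integral_def
  proof (rule nn_integral_cong_AE)
    show "AE u in lborel. ennreal (f u) * indicator {a..c} u =
        ennreal (f u) * indicator {a..b} u + ennreal (f u) * indicator {b..c} u"
      using AE_lborel_singleton[of b]
      by eventually_elim (use assms in \<open>auto simp: indicator_def\<close>)
  qed
  then show ?thesis
    by (simp add: nn_integral_add band_integral_def)
qed

lemma band_integral_add:
  assumes [measurable]: "f \<in> borel_measurable borel" "g \<in> borel_measurable borel"
    and "\<And>u. a < u \<Longrightarrow> u < b \<Longrightarrow> 0 \<le> f u \<and> 0 \<le> g u \<and> h u = f u + g u"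
  shows "band_integral a b h = band_integral a b f + band_integral a b g"
proof -
  have "band_integral a b h =
      (\<integral>\<^sup>+u. ennreal (f u) * indicator {a..b} u + ennreal (g u) * indicator {a..b} u \<partial>lborel)"
    unfolding band_integral_def
  proof (rule nn_integral_cong_AE)
    show "AE u in lborel. ennreal (h u) * indicator {a..b} u =
        ennreal (f u) * indicator {a..b} u + ennreal (g u) * indicator {a..b} u"
      using AE_lborel_singleton[of a] AE_lborel_singleton[of b]
      by eventually_elim (use assms(3) in \<open>auto simp: indicator_def ennreal_plus\<close>)
  qed
  then show ?thesis
    by (simp add: nn_integral_add band_integral_def)
qed

lemma band_integral_cmult:
  assumes [measurable]: "f \<in> borel_measurable borel" and "0 \<le> c"
    and "\<And>u. a < u \<Longrightarrow> u < b \<Longrightarrow> h u = c * f u"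
  shows "band_integral a b h = ennreal c * band_integral a b f"
proof -
  have "band_integral a b h = band_integral a b (\<lambda>u. c * f u)"
    by (rule band_integral_cong) (use assms(3) in simp)
  also have "\<dots> = (\<integral>\<^sup>+u. ennreal c * (ennreal (f u) * indicator {a..b} u) \<partial>lborel)"
    unfolding band_integral_def
    by (intro nn_integral_cong) (simp add: ennreal_mult'' ennreal_mult' assms(2) mult.assoc)
  also have "\<dots> = ennreal c * band_integral a b f"
    by (simp add: nn_integral_cmult band_integral_def)
  finally show ?thesis .
qed

text \<open>The integrands are compared only inside the interval: at an end \<open>f (g x)\<close>
  may be singular, and the convention \<open>1 / 0 = 0\<close> can then spoil the equation.\<close>

lemma band_integral_subst:
  fixes f h g g' :: "real \<Rightarrow> real"
  assumes [measurable]: "f \<in> borel_measurable borel" and "a \<le> b"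
    and "\<And>x. x \<in> {a..b} \<Longrightarrow> (g has_real_derivative g' x) (at x)"
    and "continuous_on {a..b} g'"
    and "\<And>x. x \<in> {a..b} \<Longrightarrow> 0 \<le> g' x"
    and "\<And>x. a < x \<Longrightarrow> x < b \<Longrightarrow> f (g x) * g' x = h x"
  shows "band_integral (g a) (g b) f = band_integral a b h"
proof -
  have "band_integral (g a) (g b) f = (\<integral>\<^sup>+x. ennreal (f x * indicator {g a..g b} x) \<partial>lborel)"
    unfolding band_integral_def by (intro nn_integral_cong) (auto simp: indicator_def)
  also have "\<dots> = (\<integral>\<^sup>+x. ennreal (f (g x) * g' x * indicator {a..b} x) \<partial>lborel)"
    by (rule nn_integral_substitution) (use assms in \<open>auto simp: set_borel_measurable_def\<close>)
  also have "\<dots> = band_integral a b (\<lambda>x. f (g x) * g' x)"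
    unfolding band_integral_def by (intro nn_integral_cong) (auto simp: indicator_def)
  also have "\<dots> = band_integral a b h"
    by (rule band_integral_cong) (use assms in simp)
  finally show ?thesis .
qed

lemma band_integral_reflect:
  assumes [measurable]: "f \<in> borel_measurable borel"
  shows "band_integral a b f = band_integral (-b) (-a) (\<lambda>u. f (-u))"
  unfolding band_integral_def
  by (subst nn_integral_real_affine[where c="-1" and t=0])
     (auto intro!: nn_integral_cong simp: indicator_def)

text \<open>An improper fundamental theorem: \<open>F\<close> is continuous up to the ends, where
  \<open>f\<close> may blow up, and nonnegativity turns the gauge integral into a Lebesgue
  integral.\<close>

lemma band_integral_FTC:
  assumes "finite S" "a \<le> b" "continuous_on {a..b} F"
    and deriv: "\<And>x. x \<in> {a<..<b} - S \<Longrightarrow> (F has_real_derivative f x) (at x)"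
    and nonneg: "\<And>x. x \<in> {a<..<b} \<Longrightarrow> 0 \<le> f x"
  shows "band_integral a b f = ennreal (F b - F a)"
proof -
  \<comment> \<open>The sign of \<open>f\<close> is known only inside the interval; the cut-off
    gives a nonnegative function with the same integral.\<close>
  define f0 where "f0 x = (if x \<in> {a<..<b} then f x else 0)" for x
  have I: "(f0 has_integral (F b - F a)) {a..b}"
  proof (rule fundamental_theorem_of_calculus_interior_strong[OF assms(1,2)])
    show "(F has_vector_derivative f0 x) (at x)" if "x \<in> {a<..<b} - S" for x
      using deriv[OF that] that by (simp add: f0_def has_real_derivative_iff_has_vector_derivative)
  qed (use assms in auto)
  have "band_integral a b f0 = ennreal (F b - F a)"
    unfolding band_integral_def
    by (rule nn_integral_has_integral_lebesgue'[OF _ I]) (use nonneg in \<open>auto simp: f0_def\<close>)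
  moreover have "band_integral a b f = band_integral a b f0"
    by (rule band_integral_cong) (simp add: f0_def)
  ultimately show ?thesis by simp
qed

text \<open>The composite \<open>arcsin (T x)\<close> is an antiderivative and climbs from
  \<open>- pi / 2\<close> to \<open>pi / 2\<close>. Only the end values of \<open>T\<close>
  matter.\<close>

lemma band_integral_arcsin:
  assumes "a < b" and T: "\<And>x. (T has_real_derivative T' x) (at x)"
    and ends: "T a = -1" "T b = 1"
    and inner: "\<And>x. a < x \<Longrightarrow> x < b \<Longrightarrow> \<bar>T x\<bar> < 1 \<and> h x = T' x / sqrt (1 - (T x)\<^sup>2) \<and> 0 \<le> T' x"
  shows "band_integral a b h = ennreal pi"
proof -
  have bnd: "\<bar>T x\<bar> \<le> 1" if x: "x \<in> {a..b}" for x
    using inner[of x] ends x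
    by (metis abs_1 abs_minus_cancel atLeastAtMost_iff less_le order.refl)
  have contT: "continuous_on {a..b} T"
    using T by (meson DERIV_continuous_on has_field_derivative_at_within)
  have "band_integral a b h = ennreal (arcsin (T b) - arcsin (T a))"
  proof (rule band_integral_FTC[where S="{}" and F="\<lambda>x. arcsin (T x)"])
    show "continuous_on {a..b} (\<lambda>x. arcsin (T x))"
      using bnd by (intro continuous_on_arcsin contT) (simp add: abs_le_iff minus_le_iff)
    show "((\<lambda>x. arcsin (T x)) has_real_derivative h x) (at x)" if "x \<in> {a<..<b} - {}" for x
    proof -
      have x: "-1 < T x" "T x < 1" "a < x" "x < b" using inner[of x] that by auto
      have "((\<lambda>x. arcsin (T x)) has_real_derivative inverse (sqrt (1 - (T x)\<^sup>2)) * T' x) (at x)"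
        by (rule DERIV_chain2[OF DERIV_arcsin T]) (use x in auto)
      then show ?thesis using inner[of x] x by (simp add: field_simps)
    qed
    show "0 \<le> h x" if "x \<in> {a<..<b}" for x
    proof -
      have "(T x)\<^sup>2 \<le> 1" using inner[of x] that by (simp add: abs_square_le_1)
      then show ?thesis using inner[of x] that by simp
    qed
  qed (use assms in auto)
  then show ?thesis using ends by simp
qed

section \<open>Elliptic integrals of the first kind\<close>

text \<open>For \<open>0 < b < 2\<close> this is half the complete elliptic integral of the first
  kind with modulus \<open>sqrt (1 - b\<^sup>2 / 4)\<close>, the normal form to which all three
  bands are brought.\<close>

definition period_int :: "real \<Rightarrow> ennreal" where
  "period_int b = band_integral b 2 (\<lambda>z. 1 / (sqrt (4 - z\<^sup>2) * sqrt (z\<^sup>2 - b\<^sup>2)))"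

text \<open>
  With \<open>v = u + m\<close> the map \<open>z = v + v0\<^sup>2 / v\<close> is two-to-one on the band, folding it at \<open>v = v0\<close>: this
  is the Landen transformation.
\<close>

lemma landen_band:
  fixes m v0 :: real
  assumes m: "0 < m" "m < 1" and v0: "0 < v0" "v0\<^sup>2 = 1 - m\<^sup>2"
  shows "band_integral (1 - 2 * m) 1 (\<lambda>u. (1/2) / (sqrt ((u + 2 * m)\<^sup>2 - 1) * sqrt (1 - u\<^sup>2)))
    = period_int (2 * v0)"
proof -
  define f where "f z = 1 / (sqrt (4 - z\<^sup>2) * sqrt (z\<^sup>2 - (2 * v0)\<^sup>2))" for z
  define h where "h u = 1 / (sqrt ((u + 2 * m)\<^sup>2 - 1) * sqrt (1 - u\<^sup>2))" for u
  define g where "g u = (u + m) + v0\<^sup>2 / (u + m)" for u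
  define g' where "g' u = 1 - v0\<^sup>2 / (u + m)\<^sup>2" for u
  have [measurable]: "f \<in> borel_measurable borel" "h \<in> borel_measurable borel"
    unfolding f_def h_def by measurable
  have "v0\<^sup>2 - (1 - m)\<^sup>2 = 2 * m * (1 - m)" "(1 + m)\<^sup>2 - v0\<^sup>2 = 2 * m * (1 + m)"
    unfolding v0 by (simp_all add: power2_eq_square algebra_simps)
  moreover have "0 < 2 * m * (1 - m)" "0 < 2 * m * (1 + m)" using m by auto
  ultimately have "(1 - m)\<^sup>2 < v0\<^sup>2" "v0\<^sup>2 < (1 + m)\<^sup>2" by linarith+
  \<comment> \<open>The fold \<open>u = v0 - m\<close> lies strictly inside the band.\<close>
  then have v0': "1 - m < v0" "v0 < 1 + m"
    using m v0 by (auto intro: power2_less_imp_less)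
  have deriv: "(g has_real_derivative g' u) (at u)" if "u + m > 0" for u
    unfolding g_def g'_def using that
    by (auto intro!: derivative_eq_intros simp: power2_eq_square)
  \<comment> \<open>The absolute value covers both sides of the fold. With \<open>z = g u\<close>
    one has \<open>z\<^sup>2 - 4 v0\<^sup>2 = (v - v0\<^sup>2 / v)\<^sup>2 = (v g')\<^sup>2\<close>,
    so the Jacobian cancels one of the two roots.\<close>
  have key: "f (g u) * \<bar>g' u\<bar> = h u" if u: "1 - 2 * m < u" "u < 1" "u \<noteq> v0 - m" for u
  proof -
    define v where "v = u + m"
    have v: "0 < v" "v \<noteq> v0" using u m by (auto simp: v_def)
    have u_v: "u = v - m" by (simp add: v_def)
    have g: "g u = v + v0\<^sup>2 / v" and g': "g' u = 1 - v0\<^sup>2 / v\<^sup>2"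
      by (auto simp: g_def g'_def v_def)
    have "v\<^sup>2 \<noteq> v0\<^sup>2" using v v0(1) by (simp add: power2_eq_iff)
    then have g'0: "g' u \<noteq> 0" using v by (simp add: g' field_simps)
    have "(g u)\<^sup>2 - (2 * v0)\<^sup>2 = (v * g' u)\<^sup>2"
      using v by (simp add: g g' field_simps power2_eq_square)
    then have s1: "sqrt ((g u)\<^sup>2 - (2 * v0)\<^sup>2) = v * \<bar>g' u\<bar>"
      using v by (simp add: abs_mult)
    have "v\<^sup>2 * (4 - (g u)\<^sup>2) = 4 * v\<^sup>2 - (v\<^sup>2 + v0\<^sup>2)\<^sup>2"
      using v by (simp add: g field_simps power2_eq_square)
    also have "\<dots> = ((u + 2 * m)\<^sup>2 - 1) * (1 - u\<^sup>2)"
      unfolding v0 u_v by (simp add: power2_eq_square algebra_simps)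
    finally have "4 - (g u)\<^sup>2 = ((u + 2 * m)\<^sup>2 - 1) * (1 - u\<^sup>2) / v\<^sup>2"
      using v by (simp add: field_simps)
    then have s2: "sqrt (4 - (g u)\<^sup>2) = sqrt ((u + 2 * m)\<^sup>2 - 1) * sqrt (1 - u\<^sup>2) / v"
      using v by (simp add: real_sqrt_mult real_sqrt_divide)
    show ?thesis
      unfolding f_def h_def s1 s2 using v g'0 by simp
  qed
  have sgn: "0 \<le> g' u \<longleftrightarrow> v0 \<le> u + m" if "u + m > 0" for u
    using that v0 by (simp add: g'_def field_simps power2_le_iff_abs_le)
  have "band_integral (g (v0 - m)) (g 1) f = band_integral (v0 - m) 1 h"
  proof (rule band_integral_subst)
    fix x assume x: "x \<in> {v0 - m..1}"
    then show "(g has_real_derivative g' x) (at x)" "0 \<le> g' x"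
      using v0 sgn[of x] by (auto intro!: deriv)
  next
    show "continuous_on {v0 - m..1} g'"
      unfolding g'_def using v0 by (intro continuous_intros) auto
  next
    fix x assume x: "v0 - m < x" "x < 1"
    then have "0 \<le> g' x" using sgn[of x] v0 by simp
    then show "f (g x) * g' x = h x" using key[of x] x v0' by simp
  qed (use v0' in auto)
  moreover have "g (v0 - m) = 2 * v0" "g 1 = 2" "g (1 - 2 * m) = 2"
    using v0 m by (simp_all add: g_def field_simps power2_eq_square)
  ultimately have right: "band_integral (v0 - m) 1 h = period_int (2 * v0)"
    by (simp add: period_int_def f_def[abs_def])
  \<comment> \<open>On the left half \<open>g\<close> decreases, so the increasing map
    \<open>- g\<close> is substituted; \<open>f\<close> is even, hence the mirrored interval gives
    the same integral.\<close>
  have "band_integral (- g (1 - 2 * m)) (- g (v0 - m)) f = band_integral (1 - 2 * m) (v0 - m) h"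
  proof (rule band_integral_subst)
    fix x assume x: "x \<in> {1 - 2 * m..v0 - m}"
    then show "((\<lambda>x. - g x) has_real_derivative - g' x) (at x)"
      using m by (intro DERIV_minus deriv) auto
    show "0 \<le> - g' x"
      using x m v0 by (simp add: g'_def field_simps power_mono)
  next
    show "continuous_on {1 - 2 * m..v0 - m} (\<lambda>x. - g' x)"
      unfolding g'_def using m by (intro continuous_intros) auto
  next
    fix x assume x: "1 - 2 * m < x" "x < v0 - m"
    then have "\<not> 0 \<le> g' x" using sgn[of x] m by simp
    then show "f (- g x) * - g' x = h x" using key[of x] x v0' by (simp add: f_def)
  qed (use v0' in auto)
  then have left: "band_integral (1 - 2 * m) (v0 - m) h = period_int (2 * v0)"
  proof -
    have "f \<circ> uminus = f" by (auto simp: f_def fun_eq_iff)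
    then have "band_integral (-2) (- (2 * v0)) f = band_integral (2 * v0) 2 f"
      using band_integral_reflect[of f "-2" "- (2 * v0)"] by (simp add: comp_def)
    then show ?thesis
      using \<open>band_integral (- g (1 - 2 * m)) (- g (v0 - m)) f = _\<close>
        \<open>g (v0 - m) = 2 * v0\<close> \<open>g (1 - 2 * m) = 2\<close>
      by (simp add: period_int_def f_def[abs_def])
  qed
  have "band_integral (1 - 2 * m) 1 h
      = band_integral (1 - 2 * m) (v0 - m) h + band_integral (v0 - m) 1 h"
    by (rule band_integral_split) (use v0' in auto)
  then have double: "band_integral (1 - 2 * m) 1 h = 2 * period_int (2 * v0)"
    by (simp only: left right mult_2[of "period_int _"])
  have "band_integral (1 - 2 * m) 1 (\<lambda>u. (1/2) * h u)
      = ennreal (1/2) * band_integral (1 - 2 * m) 1 h"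
    by (rule band_integral_cmult) auto
  also have "\<dots> = ennreal (1/2) * (2 * period_int (2 * v0))"
    unfolding double ..
  also have "\<dots> = ennreal (1/2) * ennreal 2 * period_int (2 * v0)"
    by (simp add: mult.assoc)
  also have "\<dots> = period_int (2 * v0)"
    by (subst ennreal_mult[symmetric]) auto
  finally show ?thesis by (simp add: h_def[abs_def])
qed

text \<open>
  Here \<open>P = sqrt (4 - k)\<close> and \<open>W = sqrt (4 + k)\<close>, so that \<open>a = W / P\<close> and
  \<open>\<sigma> c / 2 = \<sigma> (4 - P\<^sup>2) / (2 P)\<close>. The sign \<open>\<sigma> = 1\<close> belongs to \<open>m\<^sup>\<minus>\<close>, and \<open>\<sigma> = -1\<close> to \<open>m\<^sup>+\<close>, for which
  \<open>u\<close> is reflected.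
\<close>

definition lin :: "real \<Rightarrow> real \<Rightarrow> real \<Rightarrow> real \<Rightarrow> real" where
  "lin P W \<sigma> u = (W * u + \<sigma> * (4 - P\<^sup>2) / 2) / P"

definition lin_root :: "real \<Rightarrow> real \<Rightarrow> real \<Rightarrow> real" where
  "lin_root P W \<sigma> = (P - \<sigma> * (4 - P\<^sup>2) / 2) / W"

definition first_kind :: "real \<Rightarrow> real \<Rightarrow> real \<Rightarrow> real \<Rightarrow> real" where
  "first_kind P W \<sigma> u = 1 / (sqrt ((lin P W \<sigma> u)\<^sup>2 - 1) * sqrt (1 - u\<^sup>2))"

lemma measurable_first_kind [measurable]: "first_kind P W \<sigma> \<in> borel_measurable borel"
  unfolding first_kind_def lin_def by measurable

text \<open>Replacing \<open>k = 4 - P\<^sup>2\<close> by the two square roots makes the algebraic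
  identities polynomial modulo \<open>PW\<close>.\<close>

locale circle_point =
  fixes P W :: real
  assumes P: "0 < P" "P < 2" and W: "0 < W" and PW: "W\<^sup>2 = 8 - P\<^sup>2"
begin

lemma P_sq_less: "P\<^sup>2 < 4"
proof -
  have "P\<^sup>2 < 2\<^sup>2" using P by (intro power_strict_mono) auto
  then show ?thesis by simp
qed

lemma W_gt: "2 < W"
proof -
  have "2\<^sup>2 < W\<^sup>2" using PW P_sq_less by simp
  then show ?thesis using W by (auto intro: power2_less_imp_less)
qed

lemma lin_root_le_iff: "lin_root P W \<sigma> \<le> u \<longleftrightarrow> 1 \<le> lin P W \<sigma> u"
  using P W by (simp add: lin_root_def lin_def field_simps)

lemma lin_root_less_iff: "lin_root P W \<sigma> < u \<longleftrightarrow> 1 < lin P W \<sigma> u"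
  using P W by (simp add: lin_root_def lin_def field_simps)

lemma lin_at_root: "lin P W \<sigma> (lin_root P W \<sigma>) = 1"
  using P W by (simp add: lin_root_def lin_def field_simps)

lemma lin_root_minus_gt: "0 < lin_root P W (-1)"
  using P W P_sq_less by (simp add: lin_root_def field_simps add_pos_pos)

lemma lin_root_minus_less_1: "lin_root P W (-1) < 1"
proof -
  \<comment> \<open>The claim is \<open>2 P + (4 - P\<^sup>2) < 2 W\<close>. The difference of the
    squares factors, with a triple zero at \<open>P = 2\<close>, that is at \<open>k = 0\<close>,
    where the band closes.\<close>
  have "0 < (2 - P) ^ 3 * (P + 2)" using P by simp
  moreover have "(2 * W)\<^sup>2 = 4 * (8 - P\<^sup>2)"
    using PW by (simp add: power_mult_distrib)
  moreover have "4 * (8 - P\<^sup>2) - (2 * P + (4 - P\<^sup>2))\<^sup>2 = (2 - P) ^ 3 * (P + 2)"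
    by (simp add: power2_eq_square power3_eq_cube algebra_simps)
  ultimately have "2 * P + (4 - P\<^sup>2) < 2 * W"
    using W by (intro power2_less_imp_less[of _ "2 * W"]) auto
  then show ?thesis using W by (simp add: lin_root_def field_simps)
qed

lemma lin_root_less_1:
  assumes "\<sigma> = 1 \<or> \<sigma> = -1"
  shows "lin_root P W \<sigma> < 1"
proof -
  have "P - (4 - P\<^sup>2) / 2 < W" using P W_gt P_sq_less by (simp add: field_simps)
  then have "lin_root P W 1 < 1" using W by (simp add: lin_root_def)
  then show ?thesis using assms lin_root_minus_less_1 by auto
qed

lemma lin_root_gt:
  assumes "\<sigma> = 1 \<or> \<sigma> = -1"
  shows "-1 < lin_root P W \<sigma>"
proof -
  have "4 < 2 * P + 2 * W + P\<^sup>2" using P W_gt zero_le_power2[of P] by linarith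
  then have "- W < P - (4 - P\<^sup>2) / 2" by (simp add: field_simps)
  then have "-1 < lin_root P W 1" using W by (simp add: lin_root_def field_simps)
  then show ?thesis using assms lin_root_minus_gt by auto
qed

text \<open>The Moebius map \<open>M\<close> sends the branch points
  \<open>u = \<plusminus>1\<close> to \<open>\<plusminus>2\<close> and those with
  \<open>lin = \<plusminus>1\<close> to \<open>\<plusminus>P W / 2\<close>. Hence both signs of
  \<open>\<sigma>\<close> lead to the same period.\<close>

lemma first_kind_band:
  assumes \<sigma>': "\<sigma> = 1 \<or> \<sigma> = -1"
  shows "band_integral (lin_root P W \<sigma>) 1 (first_kind P W \<sigma>) = ennreal P * period_int (P * W / 2)"
proof -
  define r where "r = lin_root P W \<sigma>"
  define f where "f z = 1 / (sqrt (4 - z\<^sup>2) * sqrt (z\<^sup>2 - (P * W / 2)\<^sup>2))" for z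
  define D where "D u = W + 2 * \<sigma> * u" for u
  define M where "M u = 2 * (W * u + 2 * \<sigma>) / D u" for u
  define M' where "M' u = 2 * (W\<^sup>2 - 4) / (D u)\<^sup>2" for u
  \<comment> \<open>This \<open>c\<close> is \<open>sqrt k\<close>, not the coefficient in
    \<open>P_poly\<close>. Its square is both \<open>4 - P\<^sup>2\<close> and
    \<open>W\<^sup>2 - 4\<close>; each root below yields one factor \<open>c\<close> and the
    Jacobian two, so it drops out.\<close>
  define c where "c = sqrt (4 - P\<^sup>2)"
  have c: "0 < c" "c\<^sup>2 = 4 - P\<^sup>2" using P_sq_less by (auto simp: c_def)
  have [measurable]: "f \<in> borel_measurable borel" unfolding f_def by measurable
  have \<sigma>: "\<sigma>\<^sup>2 = 1" and abs_\<sigma>: "\<bar>\<sigma>\<bar> = 1" using \<sigma>' by auto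
  have r: "-1 < r" "r < 1" using lin_root_gt lin_root_less_1 \<sigma>' by (auto simp: r_def)
  have D: "0 < D u" if "r \<le> u" "u \<le> 1" for u
  proof -
    have "\<bar>\<sigma> * u\<bar> \<le> 1" using abs_\<sigma> that r by (simp add: abs_mult)
    then show ?thesis using W_gt by (simp add: D_def abs_le_iff)
  qed
  have "band_integral (M r) (M 1) f = band_integral r 1 (\<lambda>u. (1 / P) * first_kind P W \<sigma> u)"
  proof (rule band_integral_subst)
    fix x assume "x \<in> {r..1}"
    then have Dx: "0 < D x" using D by auto
    have "((\<lambda>u. 2 * (W * u + 2 * \<sigma>) / (W + 2 * \<sigma> * u)) has_real_derivative
        (2 * W * (W + 2 * \<sigma> * x) - 2 * (W * x + 2 * \<sigma>) * (2 * \<sigma>)) / (W + 2 * \<sigma> * x)\<^sup>2) (at x)"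
      using Dx unfolding D_def by (auto intro!: derivative_eq_intros simp: power2_eq_square)
    moreover have "2 * W * (W + 2 * \<sigma> * x) - 2 * (W * x + 2 * \<sigma>) * (2 * \<sigma>) = 2 * (W\<^sup>2 - 4 * \<sigma>\<^sup>2)"
      by (simp add: power2_eq_square algebra_simps)
    ultimately show "(M has_real_derivative M' x) (at x)"
      using \<sigma> by (simp add: M_def[abs_def] M'_def D_def)
    show "0 \<le> M' x" using Dx PW P_sq_less by (simp add: M'_def)
  next
    have "D u \<noteq> 0" if "u \<in> {r..1}" for u using D[of u] that by auto
    then show "continuous_on {r..1} M'"
      unfolding M'_def D_def by (intro continuous_intros) auto
  next
    fix u assume u: "r < u" "u < 1"
    then have Du: "0 < D u" using D by auto
    have "(D u)\<^sup>2 - (W * u + 2 * \<sigma>)\<^sup>2 = (W\<^sup>2 - 4) * (1 - u\<^sup>2) + 4 * (\<sigma>\<^sup>2 - 1) * (u\<^sup>2 - 1)"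
      by (simp add: D_def power2_eq_square algebra_simps)
    then have eq1: "(D u)\<^sup>2 - (W * u + 2 * \<sigma>)\<^sup>2 = c\<^sup>2 * (1 - u\<^sup>2)"
      using \<sigma> PW c by simp
    have M2: "(M u)\<^sup>2 = 4 * (W * u + 2 * \<sigma>)\<^sup>2 / (D u)\<^sup>2"
      by (simp only: M_def power_divide power_mult_distrib) simp
    have "4 - (M u)\<^sup>2 = 4 * ((D u)\<^sup>2 - (W * u + 2 * \<sigma>)\<^sup>2) / (D u)\<^sup>2"
      unfolding M2 using Du by (simp add: field_simps)
    then have "4 - (M u)\<^sup>2 = (2 * c / D u)\<^sup>2 * (1 - u\<^sup>2)"
      unfolding eq1 by (simp add: power_divide power_mult_distrib)
    then have s1: "sqrt (4 - (M u)\<^sup>2) = 2 * c / D u * sqrt (1 - u\<^sup>2)"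
      using Du c by (simp add: real_sqrt_mult)
    have "W * D u = W\<^sup>2 + 2 * \<sigma> * (W * u)"
      by (simp add: D_def power2_eq_square algebra_simps)
    then have WD: "W * D u = 8 - P\<^sup>2 + 2 * \<sigma> * (W * u)"
      using PW by simp
    have "4 * (W * u + 2 * \<sigma>)\<^sup>2 - P\<^sup>2 / 4 * (W * D u)\<^sup>2
        = (4 - P\<^sup>2) * ((W * u + \<sigma> * (4 - P\<^sup>2) / 2)\<^sup>2 - P\<^sup>2)"
      unfolding WD using \<sigma>' by (auto simp: power2_eq_square field_simps)
    then have eq2: "4 * (W * u + 2 * \<sigma>)\<^sup>2 - P\<^sup>2 / 4 * (W * D u)\<^sup>2
        = (c * P)\<^sup>2 * ((lin P W \<sigma> u)\<^sup>2 - 1)"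
      using c P by (simp add: lin_def power_divide power_mult_distrib right_diff_distrib)
    have "(M u)\<^sup>2 - (P * W / 2)\<^sup>2 = (4 * (W * u + 2 * \<sigma>)\<^sup>2 - P\<^sup>2 / 4 * (W * D u)\<^sup>2) / (D u)\<^sup>2"
      unfolding M2 using Du by (simp add: power_mult_distrib field_simps)
    then have "(M u)\<^sup>2 - (P * W / 2)\<^sup>2 = (c * P / D u)\<^sup>2 * ((lin P W \<sigma> u)\<^sup>2 - 1)"
      unfolding eq2 by (simp add: power_divide)
    then have s2: "sqrt ((M u)\<^sup>2 - (P * W / 2)\<^sup>2) = c * P / D u * sqrt ((lin P W \<sigma> u)\<^sup>2 - 1)"
      using Du P c by (simp add: real_sqrt_mult)
    have M': "M' u = 2 * c * c / (D u)\<^sup>2" 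
      using PW c by (simp add: M'_def power2_eq_square)
    show "f (M u) * M' u = (1 / P) * first_kind P W \<sigma> u"
      unfolding f_def s1 s2 first_kind_def M' using Du P c(1) by (simp add: power2_eq_square)
  qed (use r in auto)
  moreover have "M 1 = 2"
  proof -
    have "M 1 = 2 * D 1 / D 1" by (simp add: M_def D_def algebra_simps)
    then show ?thesis using D[of 1] r by simp
  qed
  moreover have "M r = P * W / 2"
  proof -
    have Wr: "W * r = P - \<sigma> * (4 - P\<^sup>2) / 2" using W by (simp add: r_def lin_root_def)
    have WD: "W * D r = 8 - P\<^sup>2 + 2 * \<sigma> * (W * r)"
      using PW by (simp add: D_def power2_eq_square algebra_simps)
    have "2 * (W * r + 2 * \<sigma>) * 2 = P * (W * D r)"
      unfolding WD Wr using \<sigma>' by (auto simp: power2_eq_square field_simps)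
    then show ?thesis using D[of r] r by (simp add: M_def field_simps)
  qed
  moreover have "band_integral r 1 (\<lambda>u. (1 / P) * first_kind P W \<sigma> u)
      = ennreal (1 / P) * band_integral r 1 (first_kind P W \<sigma>)"
    by (rule band_integral_cmult) (use P in auto)
  ultimately have "period_int (P * W / 2) = ennreal (1 / P) * band_integral r 1 (first_kind P W \<sigma>)"
    unfolding period_int_def f_def[abs_def] by simp
  then have "ennreal P * period_int (P * W / 2)
      = ennreal P * ennreal (1 / P) * band_integral r 1 (first_kind P W \<sigma>)"
    by (simp add: mult.assoc)
  also have "ennreal P * ennreal (1 / P) = 1"
    using P by (subst ennreal_mult[symmetric]) auto
  finally show ?thesis by (simp add: r_def)
qed

end

section \<open>The Pell equation and integrals of the third kind\<close>

context circle_point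
begin

text \<open>
  The quartic takes values \<open>\<plusminus>1\<close> simply at the four branch points and doubly at \<open>\<sigma> P\<^sup>2 / (2 W)\<close> and
  \<open>2 \<sigma> / W\<close>; comparing coefficients in \<open>pell_plus_1\<close> determines these points and \<open>\<kappa>\<close>.
\<close>

definition \<kappa> :: real where "\<kappa> = 8 * W ^ 4 / (4 - P\<^sup>2) ^ 3"

definition pell :: "real \<Rightarrow> real \<Rightarrow> real" where
  "pell \<sigma> u = 1 + \<kappa> * (u\<^sup>2 - 1) * (u - \<sigma> * P\<^sup>2 / (2 * W))\<^sup>2"

lemma \<kappa>_pos: "0 < \<kappa>"
  using W P_sq_less by (simp add: \<kappa>_def)

text \<open>The definition displays the double zero of \<open>pell - 1\<close>, this lemma that of
  \<open>pell + 1\<close>. Multiplied together they are the Pell equation: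
  \<open>1 - pell\<^sup>2\<close> is the square of a quadratic times
  \<open>(1 - u\<^sup>2) (lin\<^sup>2 - 1)\<close>.\<close>

lemma pell_plus_1:
  assumes "\<sigma> = 1 \<or> \<sigma> = -1"
  shows "1 + pell \<sigma> u = \<kappa> * (P\<^sup>2 / W\<^sup>2 * ((lin P W \<sigma> u)\<^sup>2 - 1)) * (u - \<sigma> * 2 / W)\<^sup>2"
proof -
  \<comment> \<open>After scaling by \<open>W\<close> only even powers of \<open>W\<close> occur,
    and \<open>PW\<close> eliminates them.\<close>
  define y where "y = W * u"
  have lin: "P\<^sup>2 * ((lin P W \<sigma> u)\<^sup>2 - 1) = (y + \<sigma> * (4 - P\<^sup>2) / 2)\<^sup>2 - P\<^sup>2"
    using P by (simp add: lin_def y_def power_divide right_diff_distrib)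
  have "2 * (4 - P\<^sup>2) ^ 3 + 8 * ((y\<^sup>2 - W\<^sup>2) * (y - \<sigma> * P\<^sup>2 / 2)\<^sup>2)
      = 8 * (((y + \<sigma> * (4 - P\<^sup>2) / 2)\<^sup>2 - P\<^sup>2) * (y - \<sigma> * 2)\<^sup>2)"
    unfolding PW using assms by (auto simp: power2_eq_square power3_eq_cube field_simps)
  then have "2 + 8 / (4 - P\<^sup>2) ^ 3 * ((y\<^sup>2 - W\<^sup>2) * (y - \<sigma> * P\<^sup>2 / 2)\<^sup>2)
      = 8 / (4 - P\<^sup>2) ^ 3 * ((P\<^sup>2 * ((lin P W \<sigma> u)\<^sup>2 - 1)) * (y - \<sigma> * 2)\<^sup>2)"
    unfolding lin using P_sq_less by (simp add: field_simps)
  moreover have "(y\<^sup>2 - W\<^sup>2) * (y - \<sigma> * P\<^sup>2 / 2)\<^sup>2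
      = W ^ 4 * ((u\<^sup>2 - 1) * (u - \<sigma> * P\<^sup>2 / (2 * W))\<^sup>2)"
    using W by (simp add: y_def power2_eq_square power4_eq_xxxx field_simps)
  moreover have "P\<^sup>2 * L * (y - \<sigma> * 2)\<^sup>2 = W ^ 4 * (P\<^sup>2 / W\<^sup>2 * L * (u - \<sigma> * 2 / W)\<^sup>2)" for L
    using W by (simp add: y_def power2_eq_square power4_eq_xxxx field_simps)
  ultimately have "2 + 8 / (4 - P\<^sup>2) ^ 3 * (W ^ 4 * ((u\<^sup>2 - 1) * (u - \<sigma> * P\<^sup>2 / (2 * W))\<^sup>2))
      = 8 / (4 - P\<^sup>2) ^ 3 * (W ^ 4 * (P\<^sup>2 / W\<^sup>2 * ((lin P W \<sigma> u)\<^sup>2 - 1) * (u - \<sigma> * 2 / W)\<^sup>2))"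
    by simp
  then show ?thesis
    unfolding pell_def \<kappa>_def by (simp add: mult.assoc)
qed

text \<open>One monotone run of \<open>pell\<close>, falling if \<open>\<tau> = -1\<close>. Two of
  the three critical points of the quartic are its double points; their factors cancel against
  \<open>sqrt (1 - pell\<^sup>2)\<close>, and the third, \<open>- \<sigma> W / 4\<close>, survives
  as the zero of the integrand. What is left is the derivative of
  \<open>arcsin (\<tau> pell)\<close>.\<close>

lemma pell_piece:
  assumes \<sigma>: "\<sigma> = 1 \<or> \<sigma> = -1" and \<tau>: "\<tau> = 1 \<or> \<tau> = -1"
    and xy: "x < y" "lin_root P W \<sigma> \<le> x" "y \<le> 1"
    and pos: "\<And>u. x < u \<Longrightarrow> u < y \<Longrightarrow>
      0 < \<tau> * ((u - \<sigma> * P\<^sup>2 / (2 * W)) * (u - \<sigma> * 2 / W)) \<and> 0 \<le> u + \<sigma> * W / 4"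
    and ends: "\<tau> * pell \<sigma> x = -1" "\<tau> * pell \<sigma> y = 1"
  shows "band_integral x y (\<lambda>u. 4 * W / P * (u + \<sigma> * W / 4) * first_kind P W \<sigma> u) = ennreal pi"
proof -
  define p q where "p = \<sigma> * P\<^sup>2 / (2 * W)" and "q = \<sigma> * 2 / W"
  define T' where "T' u = 4 * \<kappa> * ((u - p) * (u - q)) * (u + \<sigma> * W / 4)" for u
  have "(pell \<sigma> has_real_derivative
      \<kappa> * (2 * u * (u - p)\<^sup>2 + (u\<^sup>2 - 1) * (2 * (u - p)))) (at u)" for u
    unfolding pell_def[abs_def] p_def[symmetric]
    by (auto intro!: derivative_eq_intros simp: algebra_simps)
  \<comment> \<open>Splitting off \<open>2 (u - p)\<close> leaves
    \<open>2 u\<^sup>2 - p u - 1\<close>. Its roots are \<open>q\<close> and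
    \<open>- \<sigma> W / 4\<close> by Vieta; \<open>PW\<close> enters through their sum
    \<open>p / 2\<close>.\<close>
  moreover have "2 * u * (u - p)\<^sup>2 + (u\<^sup>2 - 1) * (2 * (u - p))
      = 4 * ((u - p) * (u - q)) * (u + \<sigma> * W / 4)" for u
  proof -
    have "q - \<sigma> * W / 4 = \<sigma> * (8 - W\<^sup>2) / (4 * W)"
      using W by (simp add: q_def field_simps power2_eq_square)
    then have "q - \<sigma> * W / 4 = p / 2"
      using PW by (simp add: p_def)
    moreover have "q * (\<sigma> * W / 4) = 1 / 2" using \<sigma> W by (auto simp: q_def)
    moreover have "(u - q) * (u + e) = u\<^sup>2 - (q - e) * u - q * e" for e
      by (simp add: power2_eq_square algebra_simps)
    ultimately have "(u - q) * (u + \<sigma> * W / 4) = u\<^sup>2 - p / 2 * u - 1 / 2"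
      by presburger
    then have "4 * ((u - p) * (u - q)) * (u + \<sigma> * W / 4) = 4 * (u - p) * (u\<^sup>2 - p / 2 * u - 1 / 2)"
      by (simp add: mult.assoc)
    then show ?thesis by (simp add: power2_eq_square algebra_simps)
  qed
  ultimately have dT: "(pell \<sigma> has_real_derivative T' u) (at u)" for u
    by (simp add: T'_def mult.assoc mult.left_commute)
  show ?thesis
  proof (rule band_integral_arcsin[where T="\<lambda>u. \<tau> * pell \<sigma> u" and T'="\<lambda>u. \<tau> * T' u"])
    show "((\<lambda>u. \<tau> * pell \<sigma> u) has_real_derivative \<tau> * T' u) (at u)" for u
      by (rule DERIV_cmult[OF dT])
    fix u assume u: "x < u" "u < y"
    have \<tau>2: "\<tau>\<^sup>2 = 1" using \<tau> by auto
    define w where "w = (u - p) * (u - q)"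
    have w: "0 < \<tau> * w" "0 \<le> u + \<sigma> * W / 4" using pos[OF u] by (auto simp: w_def p_def q_def)
    then have w0: "w \<noteq> 0" "\<bar>w\<bar> = \<tau> * w" using \<tau> by auto
    have "-1 < u" using lin_root_gt[OF \<sigma>] xy u by simp
    then have "\<bar>u\<bar> < 1" using xy u by simp
    then have u2: "0 < 1 - u\<^sup>2" by (simp add: abs_square_less_1)
    have "1 < lin P W \<sigma> u" using xy u lin_root_less_iff[of \<sigma> u] by simp
    then have l2: "0 < (lin P W \<sigma> u)\<^sup>2 - 1" by (simp add: one_less_power)
    have "1 - (pell \<sigma> u)\<^sup>2 = (1 - pell \<sigma> u) * (1 + pell \<sigma> u)"
      by (simp add: power2_eq_square algebra_simps)
    also have "\<dots> = (\<kappa> * (1 - u\<^sup>2) * (u - p)\<^sup>2)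
        * (\<kappa> * (P\<^sup>2 / W\<^sup>2 * ((lin P W \<sigma> u)\<^sup>2 - 1)) * (u - q)\<^sup>2)"
      using pell_plus_1[OF \<sigma>, of u] unfolding pell_def p_def q_def
      by (simp add: left_diff_distrib right_diff_distrib)
    also have "\<dots> = (\<kappa> * (P / W) * w)\<^sup>2 * ((1 - u\<^sup>2) * ((lin P W \<sigma> u)\<^sup>2 - 1))"
      unfolding w_def power_mult_distrib power_divide
      by (simp add: power2_eq_square mult.assoc mult.left_commute)
    finally have eq: "1 - (pell \<sigma> u)\<^sup>2
        = (\<kappa> * (P / W) * w)\<^sup>2 * ((1 - u\<^sup>2) * ((lin P W \<sigma> u)\<^sup>2 - 1))" .
    have "0 < 1 - (pell \<sigma> u)\<^sup>2"
      unfolding eq using u2 l2 w0 \<kappa>_pos P W by simp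
    then have "\<bar>\<tau> * pell \<sigma> u\<bar> < 1"
      using \<tau> by (auto simp: abs_square_less_1)
    moreover have "4 * W / P * (u + \<sigma> * W / 4) * first_kind P W \<sigma> u
        = \<tau> * T' u / sqrt (1 - (\<tau> * pell \<sigma> u)\<^sup>2)"
    proof -
      define R where "R = sqrt ((lin P W \<sigma> u)\<^sup>2 - 1) * sqrt (1 - u\<^sup>2)"
      have R: "R \<noteq> 0" using u2 l2 by (simp add: R_def)
      have "sqrt (1 - (\<tau> * pell \<sigma> u)\<^sup>2) = \<kappa> * (P / W) * (\<tau> * w) * R"
        unfolding R_def using \<kappa>_pos P W
        by (simp add: power_mult_distrib \<tau>2 eq real_sqrt_mult abs_mult w0)
      moreover have "\<tau> * T' u = 4 * \<kappa> * (\<tau> * w) * (u + \<sigma> * W / 4)"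
        by (simp add: T'_def w_def)
      moreover have "4 * W / P * E * (1 / R)
          = 4 * \<kappa> * (\<tau> * w) * E / (\<kappa> * (P / W) * (\<tau> * w) * R)" for E
        using \<kappa>_pos P W w0(1) \<tau> R by auto
      moreover have "first_kind P W \<sigma> u = 1 / R"
        by (simp add: first_kind_def R_def)
      ultimately show ?thesis by (simp only:)
    qed
    moreover have "0 \<le> \<tau> * T' u"
    proof -
      have "\<tau> * T' u = 4 * \<kappa> * (\<tau> * w) * (u + \<sigma> * W / 4)"
        by (simp add: T'_def w_def)
      also have "0 \<le> \<dots>" using w \<kappa>_pos
        by (intro mult_nonneg_nonneg[of "4 * \<kappa> * (\<tau> * w)"] mult_nonneg_nonneg[of "4 * \<kappa>"]) auto
      finally show ?thesis .
    qed
    ultimately show "\<bar>\<tau> * pell \<sigma> u\<bar> < 1 \<and> 4 * W / P * (u + \<sigma> * W / 4) * first_kind P W \<sigma> u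
        = \<tau> * T' u / sqrt (1 - (\<tau> * pell \<sigma> u)\<^sup>2) \<and> 0 \<le> \<tau> * T' u" by simp
  qed (use xy ends in auto)
qed

lemma pell_at_root:
  assumes "\<sigma> = 1 \<or> \<sigma> = -1"
  shows "pell \<sigma> (lin_root P W \<sigma>) = -1"
  using pell_plus_1[OF assms, of "lin_root P W \<sigma>"] by (simp add: lin_at_root)

text \<open>For \<open>\<sigma> = -1\<close> both double points are negative while the band is
  positive, and the third critical point \<open>W / 4\<close> does not exceed the lower end of the
  band. So \<open>pell\<close> rises only once from -1 to 1.\<close>

lemma third_kind_minus:
  "band_integral (lin_root P W (-1)) 1 (\<lambda>u. 4 * W / P * (u - W / 4) * first_kind P W (-1) u)
      = ennreal pi"
proof -
  have "0 \<le> u - W / 4" if "lin_root P W (-1) < u" for u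
  proof -
    have "P * P \<le> 4 * P" using P by (intro mult_right_mono) auto
    then have "W / 4 \<le> lin_root P W (-1)"
      using W PW by (simp add: lin_root_def field_simps power2_eq_square)
    then show ?thesis using that by simp
  qed
  moreover have "0 < (u + P\<^sup>2 / (2 * W)) * (u + 2 / W)" if "lin_root P W (-1) < u" for u
    using that lin_root_minus_gt P W by (intro mult_pos_pos add_pos_pos) auto
  ultimately show ?thesis
    using pell_piece[of "-1" 1 "lin_root P W (-1)" 1] lin_root_less_1[of "-1"] pell_at_root[of "-1"]
    by (simp add: pell_def)
qed

text \<open>For \<open>\<sigma> = 1\<close> both double points lie inside the band. At
  \<open>r < p < q < 1\<close> the quartic takes the values -1, 1, -1, 1, which makes three runs
  worth \<open>pi\<close> each, the middle one falling. This is the source of the factor 3.\<close>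

lemma third_kind_plus:
  "band_integral (lin_root P W 1) 1 (\<lambda>u. 4 * W / P * (u + W / 4) * first_kind P W 1 u)
      = 3 * ennreal pi"
proof -
  define r p q where "r = lin_root P W 1" and "p = P\<^sup>2 / (2 * W)" and "q = 2 / W"
  define f where "f u = 4 * W / P * (u + W / 4) * first_kind P W 1 u" for u
  have [measurable]: "f \<in> borel_measurable borel" unfolding f_def by measurable
  have "P * 2 < 2 * 2" using P by simp
  then have "P * 2 < 4" by simp
  then have ord: "r < p" "p < q" "q < 1"
    using W P P_sq_less W_gt by (auto simp: r_def p_def q_def lin_root_def field_simps)
  have "8 \<le> W * W + 4 * P + 2 * (P * P)"
    using PW P zero_le_square[of P] unfolding power2_eq_square by linarith
  then have pos: "0 \<le> u + W / 4" if "r < u" for u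
  proof -
    have "- (W / 4) \<le> r" 
      using W PW P \<open>8 \<le> _\<close> by (simp add: r_def lin_root_def field_simps power2_eq_square)
    then show ?thesis using that by simp
  qed
  have q: "pell 1 q = -1"
    using pell_plus_1[of 1 q] by (simp add: q_def)
  have p1: "pell 1 p = 1" "pell 1 1 = 1"
    by (simp_all add: pell_def p_def)
  have r1: "pell 1 r = -1" using pell_at_root[of 1] by (simp add: r_def)
  have "band_integral r p f = ennreal pi"
    using pell_piece[of 1 1 r p] ord pos r1 p1
    by (simp add: f_def[abs_def] r_def[symmetric] p_def[symmetric] q_def[symmetric] mult_neg_neg)
  moreover have "band_integral p q f = ennreal pi"
    using pell_piece[of 1 "-1" p q] ord pos q p1
    by (simp add: f_def[abs_def] r_def[symmetric] p_def[symmetric] q_def[symmetric] mult_pos_neg)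
  moreover have "band_integral q 1 f = ennreal pi"
    using pell_piece[of 1 1 q 1] ord pos q p1
    by (simp add: f_def[abs_def] r_def[symmetric] p_def[symmetric] q_def[symmetric])
  moreover have "band_integral r 1 f = band_integral r p f + band_integral p 1 f"
    using ord by (intro band_integral_split) auto
  moreover have "band_integral p 1 f = band_integral p q f + band_integral q 1 f"
    using ord by (intro band_integral_split) auto
  ultimately have "band_integral r 1 f = ennreal pi + (ennreal pi + ennreal pi)" by simp
  also have "\<dots> = 3 * ennreal pi"
    by (metis add.commute distrib_right mult_1 one_add_one numeral_plus_one semiring_norm(5))
  finally show ?thesis by (simp add: f_def[abs_def] r_def)
qed

end

section \<open>Splitting the parameter derivative into parts of the first and third kind\<close>

context circle_point
begin

definition third_kind :: "real \<Rightarrow> real \<Rightarrow> real" where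
  "third_kind \<sigma> u = 4 * W / P * (u + \<sigma> * W / 4) * first_kind P W \<sigma> u"

text \<open>The bracket is the \<open>k\<close>-derivative of \<open>lin\<close> at fixed
  \<open>u\<close>. It is expanded about the critical point \<open>- \<sigma> W / 4\<close> so that
  a multiple of \<open>third_kind\<close> splits off and a constant multiple of
  \<open>first_kind\<close> remains.\<close>

definition deform :: "real \<Rightarrow> real \<Rightarrow> real" where
  "deform \<sigma> u = (4 / (W * P ^ 3) * (u + \<sigma> * W / 4) + \<sigma> / (4 * P)) * first_kind P W \<sigma> u"

lemma measurable_third_kind [measurable]: "third_kind \<sigma> \<in> borel_measurable borel"
  unfolding third_kind_def by measurable

lemma measurable_deform [measurable]: "deform \<sigma> \<in> borel_measurable borel"
  unfolding deform_def by measurable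

lemma deform_eq: "deform \<sigma> u = 1 / (W\<^sup>2 * P\<^sup>2) * third_kind \<sigma> u + \<sigma> / (4 * P) * first_kind P W \<sigma> u"
proof -
  have "4 / (W * P ^ 3) = 1 / (W\<^sup>2 * P\<^sup>2) * (4 * W / P)"
    using P W by (simp add: power2_eq_square power3_eq_cube)
  then show ?thesis
    unfolding deform_def third_kind_def by (simp only: distrib_right mult.assoc)
qed

lemma first_kind_nonneg:
  assumes "\<sigma> = 1 \<or> \<sigma> = -1" "lin_root P W \<sigma> \<le> u" "u \<le> 1"
  shows "0 \<le> first_kind P W \<sigma> u"
proof -
  have "1 \<le> lin P W \<sigma> u" using assms lin_root_le_iff by simp
  then have "0 \<le> (lin P W \<sigma> u)\<^sup>2 - 1" by (simp add: one_le_power)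
  moreover have "\<bar>u\<bar> \<le> 1" using lin_root_gt[of \<sigma>] assms by auto
  then have "0 \<le> 1 - u\<^sup>2" by (simp add: abs_square_le_1)
  ultimately show ?thesis by (simp add: first_kind_def)
qed

text \<open>The expression increases with \<open>u\<close>, so the lower end of the band decides;
  there it is a positive multiple of \<open>P (P + 2 \<sigma>)\<^sup>2 (4 - \<sigma> P)\<close>. The
  case \<open>\<sigma> = -1\<close> is the delicate one, since the last term is then
  negative.\<close>

lemma deform_coeff_nonneg:
  assumes "\<sigma> = 1 \<or> \<sigma> = -1" "lin_root P W \<sigma> \<le> u"
  shows "0 \<le> 4 / (W * P ^ 3) * (u + \<sigma> * W / 4) + \<sigma> / (4 * P)"
proof -
  have Wu: "P - \<sigma> * (4 - P\<^sup>2) / 2 \<le> W * u"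
    using assms(2) W by (simp add: lin_root_def field_simps)
  have "0 \<le> 16 * (P - \<sigma> * (4 - P\<^sup>2) / 2) + 4 * \<sigma> * (8 - P\<^sup>2) + \<sigma> * (8 - P\<^sup>2) * P\<^sup>2"
  proof -
    have "16 * (P - \<sigma> * (4 - P\<^sup>2) / 2) + 4 * \<sigma> * (8 - P\<^sup>2) + \<sigma> * (8 - P\<^sup>2) * P\<^sup>2
        = P * (P + 2 * \<sigma>)\<^sup>2 * (4 - \<sigma> * P)"
      using assms(1) by (auto simp: power2_eq_square field_simps)
    moreover have "0 \<le> 4 - \<sigma> * P" using assms(1) P by auto
    ultimately show ?thesis using P by simp
  qed
  also have "\<dots> \<le> 16 * (W * u) + 4 * \<sigma> * W\<^sup>2 + \<sigma> * W\<^sup>2 * P\<^sup>2"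
    using Wu PW by simp
  also have "\<dots> = 4 * W\<^sup>2 * P ^ 3 * (4 / (W * P ^ 3) * (u + \<sigma> * W / 4) + \<sigma> / (4 * P))"
    using W P by (simp add: power2_eq_square power3_eq_cube field_simps)
  finally have "0 \<le> \<dots>" .
  moreover have "0 < 4 * W\<^sup>2 * P ^ 3" using W P by simp
  ultimately show ?thesis by (meson mult_pos_neg not_le)
qed

text \<open>With the period \<open>K = 4 K4\<close>, the first integral is \<open>K\<close>, that of
  \<open>deform (-1)\<close> is \<open>c pi - K4\<close>, and that of \<open>deform 1\<close> is
  \<open>3 c pi + K4\<close>. The claim is then
  \<open>4 K4 + 3 (c pi - K4) = 3 c pi + K4\<close>.\<close>

lemma deform_identity:
  "band_integral (1 - (4 - P\<^sup>2) / 2) 1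
     (\<lambda>u. (1/2) / (sqrt ((u + (4 - P\<^sup>2) / 2)\<^sup>2 - 1) * sqrt (1 - u\<^sup>2)))
   + 3 * band_integral (lin_root P W (-1)) 1 (deform (-1))
   = band_integral (lin_root P W 1) 1 (deform 1)"
proof -
  define K where "K = period_int (P * W / 2)"
  define K4 where "K4 = ennreal (1 / (4 * P)) * (ennreal P * K)"
  define c where "c = ennreal (1 / (W\<^sup>2 * P\<^sup>2))"
  have first: "band_integral (lin_root P W \<sigma>) 1 (\<lambda>u. 1 / (4 * P) * first_kind P W \<sigma> u) = K4"
    if "\<sigma> = 1 \<or> \<sigma> = -1" for \<sigma>
    unfolding K4_def K_def first_kind_band[OF that, symmetric]
    by (rule band_integral_cmult) (use P in auto)
  have third: "band_integral (lin_root P W \<sigma>) 1 (\<lambda>u. 1 / (W\<^sup>2 * P\<^sup>2) * third_kind \<sigma> u)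
      = c * band_integral (lin_root P W \<sigma>) 1 (third_kind \<sigma>)" for \<sigma>
    unfolding c_def by (rule band_integral_cmult) auto
  have third_nonneg: "0 \<le> third_kind 1 u" if u: "lin_root P W 1 < u" "u < 1" for u
  proof -
    have "8 \<le> W * W + 4 * P + 2 * (P * P)"
      using PW P zero_le_square[of P] unfolding power2_eq_square by linarith
    then have "- (W / 4) \<le> lin_root P W 1"
      using W PW P by (simp add: lin_root_def field_simps power2_eq_square)
    then show ?thesis
      unfolding third_kind_def using u P W first_kind_nonneg[of 1 u]
      by (intro mult_nonneg_nonneg) auto
  qed
  have "band_integral (lin_root P W 1) 1 (deform 1)
      = band_integral (lin_root P W 1) 1 (\<lambda>u. 1 / (W\<^sup>2 * P\<^sup>2) * third_kind 1 u)
      + band_integral (lin_root P W 1) 1 (\<lambda>u. 1 / (4 * P) * first_kind P W 1 u)"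
    by (rule band_integral_add)
       (use P third_nonneg first_kind_nonneg[of 1] deform_eq[of 1] in auto)
  then have plus: "band_integral (lin_root P W 1) 1 (deform 1) = c * (3 * ennreal pi) + K4"
    unfolding third first[OF disjI1[OF refl]] using third_kind_plus
    by (simp add: third_kind_def[abs_def])
  \<comment> \<open>For \<open>\<sigma> = -1\<close> the first-kind part enters with a minus sign.
    It is moved to the other side because subtraction in \<open>ennreal\<close> truncates.\<close>
  have "band_integral (lin_root P W (-1)) 1 (\<lambda>u. 1 / (W\<^sup>2 * P\<^sup>2) * third_kind (-1) u)
      = band_integral (lin_root P W (-1)) 1 (deform (-1))
      + band_integral (lin_root P W (-1)) 1 (\<lambda>u. 1 / (4 * P) * first_kind P W (-1) u)"
  proof (rule band_integral_add)
    fix u assume u: "lin_root P W (-1) < u" "u < 1"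
    have "0 \<le> deform (-1) u"
      unfolding deform_def using u first_kind_nonneg[of "-1" u] deform_coeff_nonneg[of "-1" u]
      by (intro mult_nonneg_nonneg) auto
    then show "0 \<le> deform (-1) u \<and> 0 \<le> 1 / (4 * P) * first_kind P W (-1) u \<and>
        1 / (W\<^sup>2 * P\<^sup>2) * third_kind (-1) u = deform (-1) u + 1 / (4 * P) * first_kind P W (-1) u"
      using u P first_kind_nonneg[of "-1" u] deform_eq[of "-1" u] by simp
  qed auto
  then have minus: "band_integral (lin_root P W (-1)) 1 (deform (-1)) + K4 = c * ennreal pi"
    unfolding third first[OF disjI2[OF refl]] using third_kind_minus
    by (simp add: third_kind_def[abs_def])
  \<comment> \<open>The Landen lemma is applied with \<open>m = (4 - P\<^sup>2) / 4\<close> and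
    \<open>v0 = P W / 4\<close>, so its period has the argument \<open>P W / 2\<close> of
    \<open>first_kind_band\<close>.\<close>
  have "(P * W / 4)\<^sup>2 = 1 - ((4 - P\<^sup>2) / 4)\<^sup>2"
    using PW by (simp add: power_mult_distrib power_divide) (simp add: power2_eq_square field_simps)
  then have "band_integral (1 - 2 * ((4 - P\<^sup>2) / 4)) 1
     (\<lambda>u. (1/2) / (sqrt ((u + 2 * ((4 - P\<^sup>2) / 4))\<^sup>2 - 1) * sqrt (1 - u\<^sup>2)))
         = period_int (2 * (P * W / 4))"
    using P W P_sq_less by (intro landen_band) auto
  moreover have "2 * ((4 - P\<^sup>2) / 4) = (4 - P\<^sup>2) / 2" "2 * (P * W / 4) = P * W / 2" by simp_all
  ultimately have landen: "band_integral (1 - (4 - P\<^sup>2) / 2) 1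
     (\<lambda>u. (1/2) / (sqrt ((u + (4 - P\<^sup>2) / 2)\<^sup>2 - 1) * sqrt (1 - u\<^sup>2))) = K"
    by (simp only: K_def)
  have "ennreal (1 / (4 * P)) * ennreal P = ennreal (1 / 4)"
    using P by (simp flip: ennreal_mult)
  moreover have "4 * ennreal (1 / 4) = 1"
    using ennreal_mult[of 4 "1 / 4"] by simp
  ultimately have "4 * K4 = K"
    by (simp add: K4_def flip: mult.assoc)
  moreover have "K4 + 3 * K4 = (1 + 3) * K4" by (simp only: distrib_right mult_1)
  ultimately have K: "K = K4 + 3 * K4" by simp
  have "K + 3 * B = K4 + 3 * (B + K4)" for B
    by (subst K) (simp add: distrib_left ac_simps)
  from this[of "band_integral (lin_root P W (-1)) 1 (deform (-1))"] show ?thesis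
    unfolding landen plus minus by (simp add: ac_simps)
qed

end

section \<open>Integration over the deformation parameter\<close>

definition arcosh_plus :: "real \<Rightarrow> real" where
  "arcosh_plus t = arcosh (max 1 t)"

lemma arcosh_plus_nonneg: "0 \<le> arcosh_plus t"
  by (simp add: arcosh_plus_def)

lemma continuous_on_arcosh_plus [continuous_intros]:
  fixes f :: "real \<Rightarrow> real"
  assumes "continuous_on A f"
  shows "continuous_on A (\<lambda>x. arcosh_plus (f x))"
  unfolding arcosh_plus_def using assms
  by (intro continuous_on_arcosh' continuous_on_max continuous_on_const) auto

lemma measurable_arcosh_plus [measurable]: "arcosh_plus \<in> borel_measurable borel"
  by (rule borel_measurable_continuous_onI) (intro continuous_intros)

lemma arcosh_plus_eq_0: "t \<le> 1 \<Longrightarrow> arcosh_plus t = 0"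
  by (simp add: arcosh_plus_def max_def)

lemma arcosh_plus_eq: "1 \<le> t \<Longrightarrow> arcosh_plus t = arcosh t"
  by (simp add: arcosh_plus_def max_def)

text \<open>A common frame for the three families: an affine function of \<open>u\<close> with slope
  \<open>\<alpha> s\<close> that equals 1 at \<open>R s\<close>, so that the band is
  \<open>{R s..1}\<close>. It is degenerate at \<open>s = 0\<close> and grows with \<open>s\<close>;
  the sign conditions make the \<open>s\<close>-derivative nonnegative.\<close>

locale band_family =
  fixes \<alpha> R \<alpha>' R' :: "real \<Rightarrow> real" and k :: real
  assumes k: "0 < k"
    and measurable [measurable]: "\<alpha> \<in> borel_measurable borel" "R \<in> borel_measurable borel"
      "\<alpha>' \<in> borel_measurable borel" "R' \<in> borel_measurable borel"
    and deriv_\<alpha>: "\<And>s. 0 < s \<Longrightarrow> s < k \<Longrightarrow> (\<alpha> has_real_derivative \<alpha>' s) (at s)"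
    and deriv_R: "\<And>s. 0 < s \<Longrightarrow> s < k \<Longrightarrow> (R has_real_derivative R' s) (at s)"
    and cont_\<alpha>: "continuous_on {0..k} \<alpha>" and cont_R: "continuous_on {0..k} R"
    and \<alpha>_pos: "\<And>s. 0 \<le> s \<Longrightarrow> s \<le> k \<Longrightarrow> 0 < \<alpha> s"
    and \<alpha>'_nonneg: "\<And>s. 0 < s \<Longrightarrow> s < k \<Longrightarrow> 0 \<le> \<alpha>' s"
    and R'_neg: "\<And>s. 0 < s \<Longrightarrow> s < k \<Longrightarrow> R' s < 0"
    and R_0: "R 0 = 1"
    and R_ge: "\<And>s. 0 < s \<Longrightarrow> s < k \<Longrightarrow> -1 \<le> R s"
begin

definition g :: "real \<Rightarrow> real \<Rightarrow> real" where
  "g s u = 1 + \<alpha> s * (u - R s)"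

definition dg :: "real \<Rightarrow> real \<Rightarrow> real" where
  "dg s u = \<alpha>' s * (u - R s) - \<alpha> s * R' s"

definition density :: "real \<Rightarrow> real \<Rightarrow> real" where
  "density s u = (if R s < u then dg s u / sqrt ((g s u)\<^sup>2 - 1) else 0)"

lemma measurable_density [measurable]: "(\<lambda>(s, u). density s u) \<in> borel_measurable (borel \<Otimes>\<^sub>M borel)"
  unfolding density_def dg_def g_def by measurable

lemma density_nonneg:
  assumes "0 < s" "s < k"
  shows "0 \<le> density s u"
proof (cases "R s < u")
  case True
  have "0 \<le> \<alpha> s * (u - R s)" using \<alpha>_pos[of s] assms True by simp
  then have "1 \<le> g s u" by (simp add: g_def)
  then have "0 \<le> (g s u)\<^sup>2 - 1" by (simp add: one_le_power)
  moreover have "0 \<le> \<alpha>' s * (u - R s)" using \<alpha>'_nonneg[of s] assms True by simp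
  moreover have "\<alpha> s * R' s \<le> 0" using \<alpha>_pos[of s] R'_neg[of s] assms
      by (simp add: mult_nonneg_nonpos)
  ultimately show ?thesis using True by (simp add: density_def dg_def)
qed (simp add: density_def)

lemma R_strict_decreasing:
  assumes "0 \<le> s" "s < t" "t \<le> k"
  shows "R t < R s"
proof (rule DERIV_neg_imp_decreasing_open[OF assms(2)])
  show "\<exists>y. (R has_real_derivative y) (at x) \<and> y < 0" if "s < x" "x < t" for x
    using deriv_R[of x] R'_neg[of x] that assms by auto
  show "continuous_on {s..t} R"
    by (rule continuous_on_subset[OF cont_R]) (use assms in auto)
qed

text \<open>The fundamental theorem in \<open>s\<close> for fixed \<open>u\<close>: since
  \<open>u \<le> 1 = R 0\<close>, the starting value is 0.\<close>

lemma arcosh_plus_eq_integral: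
  assumes "u \<le> 1"
  shows "ennreal (arcosh_plus (g k u)) = band_integral 0 k (\<lambda>s. density s u)"
proof -
  \<comment> \<open>Differentiability may fail when the end of the band passes through
    \<open>u\<close>; since \<open>R\<close> is strictly decreasing, this happens for at most one
    \<open>s\<close>.\<close>
  define S where "S = {s \<in> {0..k}. R s = u}"
  have "s = t" if "s \<in> S" "t \<in> S" for s t
    using R_strict_decreasing[of s t] R_strict_decreasing[of t s] that
    by (cases s t rule: linorder_cases) (auto simp: S_def)
  then have "finite S"
    by (metis finite.simps finite_subset insertI1 subsetI)
  moreover have "continuous_on {0..k} (\<lambda>s. arcosh_plus (g s u))"
    unfolding g_def by (intro continuous_intros cont_\<alpha> cont_R)
  moreover have "((\<lambda>s. arcosh_plus (g s u)) has_real_derivative density s u) (at s)"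
    if s: "s \<in> {0<..<k} - S" for s
  proof -
    have s': "0 < s" "s < k" "R s \<noteq> u" using s by (auto simp: S_def)
    have dg: "((\<lambda>s. g s u) has_real_derivative dg s u) (at s)"
      unfolding g_def dg_def using s'
      by (auto intro!: derivative_eq_intros deriv_\<alpha> deriv_R simp: algebra_simps)
    have cont: "((\<lambda>s. g s u) \<longlongrightarrow> g s u) (at s)"
      using DERIV_isCont[OF dg] by (simp add: isCont_def)
    show ?thesis
    proof (cases "R s < u")
      case True
      then have gt: "1 < g s u" using \<alpha>_pos[of s] s' by (simp add: g_def)
      have "((\<lambda>s. arcosh (g s u)) has_real_derivative 1 / sqrt ((g s u)\<^sup>2 - 1) * dg s u) (at s)"
        by (rule DERIV_chain2[OF arcosh_real_has_field_derivative dg]) (use gt in auto)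
      moreover have "\<forall>\<^sub>F t in at s. arcosh_plus (g t u) = arcosh (g t u)"
        using order_tendstoD(1)[OF cont gt] by eventually_elim (simp add: arcosh_plus_eq)
      ultimately show ?thesis
        using True gt by (subst has_field_derivative_cong_eventually[where g="\<lambda>s. arcosh (g s u)"])
          (auto simp: density_def arcosh_plus_eq)
    next
      case False
      then have "\<alpha> s * (u - R s) < 0" using \<alpha>_pos[of s] s' by (simp add: mult_pos_neg)
      then have lt: "g s u < 1" by (simp add: g_def)
      have "\<forall>\<^sub>F t in at s. arcosh_plus (g t u) = 0"
        using order_tendstoD(2)[OF cont lt] by eventually_elim (simp add: arcosh_plus_eq_0)
      then show ?thesis
        using False lt by (subst has_field_derivative_cong_eventually[where g="\<lambda>_. 0"])
          (auto simp: density_def arcosh_plus_eq_0)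
    qed
  qed
  ultimately have "band_integral 0 k (\<lambda>s. density s u)
      = ennreal (arcosh_plus (g k u) - arcosh_plus (g 0 u))"
    using k density_nonneg by (intro band_integral_FTC[where S=S]) auto
  moreover have "\<alpha> 0 * (u - 1) \<le> 0" using \<alpha>_pos[of 0] k assms by (simp add: mult_nonneg_nonpos)
  then have "arcosh_plus (g 0 u) = 0" by (intro arcosh_plus_eq_0) (simp add: g_def R_0)
  ultimately show ?thesis by simp
qed

text \<open>The weight \<open>1 / sqrt (1 - u\<^sup>2)\<close> comes from \<open>u = cos t\<close>.
  After the exchange of integrals, \<open>density\<close> restricts \<open>u\<close> to the band
  belonging to \<open>s\<close>.\<close>

lemma tonelli:
  "band_integral (-1) 1 (\<lambda>u. arcosh_plus (g k u) / sqrt (1 - u\<^sup>2))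
   = (\<integral>\<^sup>+s. band_integral (R s) 1 (\<lambda>u. dg s u / (sqrt ((g s u)\<^sup>2 - 1) * sqrt (1 - u\<^sup>2)))
        * indicator {0..k} s \<partial>lborel)"
proof -
  define w :: "real \<Rightarrow> ennreal" where "w u
      = ennreal (1 / sqrt (1 - u\<^sup>2)) * indicator {-1..1} u" for u
  have [measurable]: "w \<in> borel_measurable borel" unfolding w_def by measurable
  have "band_integral (-1) 1 (\<lambda>u. arcosh_plus (g k u) / sqrt (1 - u\<^sup>2))
      = (\<integral>\<^sup>+u. band_integral 0 k (\<lambda>s. density s u) * w u \<partial>lborel)"
    unfolding band_integral_def[of "-1"]
  proof (rule nn_integral_cong)
    fix u :: real
    show "ennreal (arcosh_plus (g k u) / sqrt (1 - u\<^sup>2)) * indicator {-1..1} u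
        = band_integral 0 k (\<lambda>s. density s u) * w u"
    proof (cases "u \<in> {-1..1}")
      case True
      then have "0 \<le> 1 - u\<^sup>2" by (simp add: abs_square_le_1 abs_le_iff)
      then have "ennreal (arcosh_plus (g k u) / sqrt (1 - u\<^sup>2))
          = ennreal (arcosh_plus (g k u)) * ennreal (1 / sqrt (1 - u\<^sup>2))"
        by (simp add: arcosh_plus_nonneg flip: ennreal_mult)
      then show ?thesis using True arcosh_plus_eq_integral[of u] by (simp add: w_def)
    qed (simp add: w_def)
  qed
  also have "\<dots> = (\<integral>\<^sup>+u. (\<integral>\<^sup>+s. ennreal (density s u) * indicator {0..k} s * w u \<partial>lborel) \<partial>lborel)"
    unfolding band_integral_def by (intro nn_integral_cong) (simp add: nn_integral_multc)
  also have "\<dots> = (\<integral>\<^sup>+s. (\<integral>\<^sup>+u. ennreal (density s u) * indicator {0..k} s * w u \<partial>lborel) \<partial>lborel)"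
    by (rule lborel_pair.Fubini') measurable
  also have "\<dots> = (\<integral>\<^sup>+s. band_integral (R s) 1 (\<lambda>u. dg s u / (sqrt ((g s u)\<^sup>2 - 1) * sqrt (1 - u\<^sup>2)))
      * indicator {0..k} s \<partial>lborel)"
  proof (rule nn_integral_cong_AE)
    show "AE s in lborel. (\<integral>\<^sup>+u. ennreal (density s u) * indicator {0..k} s * w u \<partial>lborel)
      = band_integral (R s) 1 (\<lambda>u. dg s u / (sqrt ((g s u)\<^sup>2 - 1) * sqrt (1 - u\<^sup>2)))
        * indicator {0..k} s"
      using AE_lborel_singleton[of 0] AE_lborel_singleton[of k]
    proof eventually_elim
      case (elim s)
      show ?case
      proof (cases "s \<in> {0..k}")
        case True
        then have s: "0 < s" "s < k" using elim by auto
        have "(\<integral>\<^sup>+u. ennreal (density s u) * w u \<partial>lborel)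
          = band_integral (R s) 1 (\<lambda>u. dg s u / (sqrt ((g s u)\<^sup>2 - 1) * sqrt (1 - u\<^sup>2)))"
          unfolding band_integral_def
        proof (rule nn_integral_cong_AE)
          show "AE u in lborel. ennreal (density s u) * w u =
            ennreal (dg s u / (sqrt ((g s u)\<^sup>2 - 1) * sqrt (1 - u\<^sup>2))) * indicator {R s..1} u"
            using AE_lborel_singleton[of "R s"]
          proof eventually_elim
            case (elim u)
            show ?case
            proof (cases "R s < u \<and> u \<le> 1")
              case True
              then have "-1 \<le> u" using R_ge[OF s] by simp
              then have "0 \<le> 1 - u\<^sup>2" using True by (simp add: abs_square_le_1 abs_le_iff)
              then have "ennreal (density s u) * ennreal (1 / sqrt (1 - u\<^sup>2))
                  = ennreal (density s u * (1 / sqrt (1 - u\<^sup>2)))"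
                using density_nonneg[OF s] \<open>0 \<le> 1 - u\<^sup>2\<close> by (subst ennreal_mult) auto
              then show ?thesis
                using True \<open>-1 \<le> u\<close> by (simp add: w_def density_def)
            next
              case False
              then show ?thesis using elim by (auto simp: w_def density_def)
            qed
          qed
        qed
        then show ?thesis using True by simp
      qed simp
    qed
  qed
  finally show ?thesis .
qed

end

section \<open>Jensen's formula for a linear factor\<close>

definition circ :: "real \<Rightarrow> complex" where
  "circ \<theta> = exp (2 * of_real pi * \<i> * of_real \<theta>)"

lemma circlepath_circ: "circlepath 0 1 = circ"
  by (simp add: circlepath circ_def fun_eq_iff)

lemma vector_derivative_circ: "vector_derivative circ (at x) = 2 * of_real pi * \<i> * circ x"
  using vector_derivative_circlepath[of 0 1 x] by (simp add: circlepath_circ) (simp add: circ_def)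

lemma continuous_on_circ [continuous_intros]: "continuous_on A circ"
  unfolding circ_def by (intro continuous_intros)

lemma measurable_circ [measurable]: "circ \<in> borel_measurable borel"
  by (rule borel_measurable_continuous_onI) (rule continuous_on_circ)

lemma norm_circ [simp]: "cmod (circ \<theta>) = 1"
  by (simp add: circ_def)

lemma circ_nonzero [simp]: "circ \<theta> \<noteq> 0"
  by (simp add: circ_def)

lemma circ_plus_inverse: "circ \<theta> + 1 / circ \<theta> = of_real (2 * cos (2 * pi * \<theta>))"
proof -
  have "circ \<theta> = cis (2 * pi * \<theta>)"
    by (simp add: circ_def cis_conv_exp mult_ac)
  then show ?thesis
    by (simp add: complex_eq_iff field_simps flip: cis_cnj cis_inverse inverse_eq_divide)
qed

text \<open>The exceptional set is empty or contained in a coset of the integers, hence countable.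
  This removes the points where a linear factor vanishes and \<open>ln\<close> is not
  additive.\<close>

lemma AE_circ_neq: "AE \<theta> in lborel. circ \<theta> \<noteq> w"
proof -
  have "countable {\<theta>. circ \<theta> = w}"
  proof (cases "\<exists>\<theta>\<^sub>0. circ \<theta>\<^sub>0 = w")
    case True
    then obtain \<theta>\<^sub>0 where \<theta>0: "circ \<theta>\<^sub>0 = w" by blast
    have "{\<theta>. circ \<theta> = w} \<subseteq> range (\<lambda>n::int. \<theta>\<^sub>0 + of_int n)"
    proof
      fix \<theta> assume "\<theta> \<in> {\<theta>. circ \<theta> = w}"
      then have "exp (2 * of_real pi * \<i> * of_real \<theta>)
          = exp (2 * of_real pi * \<i> * complex_of_real \<theta>\<^sub>0)"
        using \<theta>0 by (simp add: circ_def)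
      then obtain n :: int where
        "2 * of_real pi * \<i> * of_real \<theta>
            = 2 * of_real pi * \<i> * complex_of_real \<theta>\<^sub>0 + (of_int (2 * n) * pi) * \<i>"
        unfolding exp_eq by blast
      then have "2 * of_real pi * \<i> * complex_of_real \<theta>
          = 2 * of_real pi * \<i> * complex_of_real (\<theta>\<^sub>0 + of_int n)"
        by (simp add: algebra_simps)
      then have "complex_of_real \<theta> = complex_of_real (\<theta>\<^sub>0 + of_int n)"
        by (subst (asm) mult_cancel_left) auto
      then have "\<theta> = \<theta>\<^sub>0 + of_int n" by (simp only: of_real_eq_iff)
      then show "\<theta> \<in> range (\<lambda>n::int. \<theta>\<^sub>0 + of_int n)" by blast
    qed
    then show ?thesis by (rule countable_subset) auto
  qed simp
  then have "AE \<theta> in lborel. \<theta> \<notin> {\<theta>. circ \<theta> = w}"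
    by (intro AE_not_in countable_imp_null_set_lborel)
  then show ?thesis by simp
qed

text \<open>The mean value property for the real part of \<open>Ln (1 - v z)\<close>, which is 0 at
  the centre. On the closed disc \<open>Re (1 - v z) > 0\<close>, so the principal branch is
  holomorphic there.\<close>

lemma jensen_inside:
  assumes v: "cmod v < 1"
  shows "continuous_on {0..1} (\<lambda>\<theta>. ln (cmod (1 - v * circ \<theta>)))"
    and "(\<integral>\<theta>\<in>{0..1}. ln (cmod (1 - v * circ \<theta>)) \<partial>lborel) = 0"
proof -
  have pos: "0 < Re (1 - v * z)" if "cmod z \<le> 1" for z
  proof -
    have "cmod (v * z) < 1"
      using mult_left_le[of "cmod z" "cmod v"] that v by (simp add: norm_mult)
    then show ?thesis using complex_Re_le_cmod[of "v * z"] by simp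
  qed
  then have nz: "1 - v * circ \<theta> \<noteq> 0" for \<theta>
    using pos[of "circ \<theta>"] by force
  show cont: "continuous_on {0..1} (\<lambda>\<theta>. ln (cmod (1 - v * circ \<theta>)))"
    using nz by (intro continuous_intros) auto
  have "(\<lambda>z. Ln (1 - v * z)) holomorphic_on cball 0 1"
    using pos by (intro holomorphic_intros) (auto simp: complex_nonpos_Reals_iff dest!: pos)
  then have "((\<lambda>z. Ln (1 - v * z) / (z - 0))
      has_contour_integral (2 * of_real pi * \<i> * Ln (1 - v * 0)))
      (circlepath 0 1)"
    by (rule Cauchy_integral_circlepath_simple) simp
  then have "((\<lambda>\<theta>. Ln (1 - v * circ \<theta>) / circ \<theta> * (2 * of_real pi * \<i> * circ \<theta>))
      has_integral 0) {0..1}"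
    by (simp add: has_contour_integral circlepath_circ vector_derivative_circ)
  then have "((\<lambda>\<theta>. 2 * of_real pi * \<i> * Ln (1 - v * circ \<theta>)) has_integral 0) {0..1}"
    by (simp add: mult_ac)
  then have "((\<lambda>\<theta>. Ln (1 - v * circ \<theta>)) has_integral 0) {0..1}"
    using has_integral_mult_right[of _ 0 "{0..1}" "1 / (2 * of_real pi * \<i>)"] by fastforce
  from has_integral_Re[OF this] have "((\<lambda>\<theta>. ln (cmod (1 - v * circ \<theta>))) has_integral 0) {0..1}"
    using nz by simp
  then show "(\<integral>\<theta>\<in>{0..1}. ln (cmod (1 - v * circ \<theta>)) \<partial>lborel) = 0"
    using set_borel_integral_eq_integral(2)[OF borel_integrable_atLeastAtMost'[OF cont]]
    by (simp add: integral_unique)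
qed

text \<open>
  Radial limit of \<open>jensen_inside\<close>: Fatou gives integrability on the boundary, which then supplies
  the dominating function because \<open>|1 - z| \<le> 2 |1 - r z|\<close> for \<open>|z| = 1\<close>.
\<close>

lemma jensen_boundary:
  assumes v: "cmod v = 1"
  shows "set_integrable lborel {0..1} (\<lambda>\<theta>. ln (cmod (1 - v * circ \<theta>)))"
    and "(\<integral>\<theta>\<in>{0..1}. ln (cmod (1 - v * circ \<theta>)) \<partial>lborel) = 0"
proof -
  define r where "r n = 1 - inverse (real (Suc n))" for n
  have r: "0 \<le> r n" "r n < 1" for n
    unfolding r_def by (simp_all add: divide_simps)
  have r_lim: "(\<lambda>n. complex_of_real (r n)) \<longlonglongrightarrow> of_real 1"
    unfolding r_def by (intro tendsto_intros)
        (rule tendsto_eq_intros LIMSEQ_inverse_real_of_nat refl | simp)+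
  define L where "L z \<theta> = ln (cmod (1 - z * v * circ \<theta>))" for z \<theta>
  have L_measurable [measurable]: "L z \<in> borel_measurable borel" for z
    unfolding L_def by measurable
  have inside: "set_integrable lborel {0..1} (L (r n))" "(\<integral>\<theta>\<in>{0..1}. L (r n) \<theta> \<partial>lborel) = 0" for n
    using jensen_inside[of "r n * v"] r[of n] v
    by (auto simp: L_def[abs_def] norm_mult intro!: borel_integrable_atLeastAtMost')
  have upper: "L z \<theta> \<le> ln 2" if "cmod z \<le> 1" "1 - z * v * circ \<theta> \<noteq> 0" for z \<theta>
  proof -
    have "cmod (1 - z * v * circ \<theta>) \<le> 1 + 1"
      by (rule order_trans[OF norm_triangle_ineq4]) (use that v in \<open>simp add: norm_mult\<close>)
    then show ?thesis using that by (simp add: L_def)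
  qed
  have nz: "1 - r n * v * circ \<theta> \<noteq> 0" for n \<theta>
  proof
    assume "1 - r n * v * circ \<theta> = 0"
    then have "cmod (r n * v * circ \<theta>) = 1" by simp
    then show False using r[of n] v by (simp add: norm_mult)
  qed
  \<comment> \<open>With \<open>|z| = 1\<close> and \<open>0 \<le> r < 1\<close>:
    \<open>|1 - z| \<le> |1 - r z| + (1 - r)\<close>, and
    \<open>1 - r \<le> |1 - r z|\<close>.\<close>
  have lower: "L 1 \<theta> - ln 2 \<le> L (r n) \<theta>" if "1 - v * circ \<theta> \<noteq> 0" for n \<theta>
  proof -
    have "1 - v * circ \<theta> = (1 - r n * v * circ \<theta>) - (1 - r n) * v * circ \<theta>"
      by (simp add: algebra_simps)
    then have "cmod (1 - v * circ \<theta>) \<le> cmod (1 - r n * v * circ \<theta>) + cmod ((1 - r n) * v * circ \<theta>)"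
      using norm_triangle_ineq4 by metis
    also have "cmod ((1 - r n) * v * circ \<theta>) = 1 - r n"
      using r[of n] v by (simp add: norm_mult del: of_real_diff)
    also have "1 - r n \<le> cmod (1 - r n * v * circ \<theta>)"
      using norm_triangle_ineq2[of 1 "r n * v * circ \<theta>"] r[of n] v by (simp add: norm_mult)
    finally have "cmod (1 - v * circ \<theta>) / 2 \<le> cmod (1 - r n * v * circ \<theta>)" by simp
    then have "ln (cmod (1 - v * circ \<theta>) / 2) \<le> ln (cmod (1 - r n * v * circ \<theta>))"
      using that by (intro ln_mono) auto
    then show ?thesis using that by (simp add: L_def ln_div)
  qed
  have "AE \<theta> in lborel. circ \<theta> \<noteq> inverse v" by (rule AE_circ_neq)
  then have AE_nz: "AE \<theta> in lborel. 1 - v * circ \<theta> \<noteq> 0"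
  proof eventually_elim
    case (elim \<theta>)
    have "v \<noteq> 0" using v by auto
    then show ?case using elim by (auto simp: field_simps)
  qed
  have lim: "(\<lambda>n. L (r n) \<theta>) \<longlonglongrightarrow> L 1 \<theta>" if "1 - v * circ \<theta> \<noteq> 0" for \<theta>
    unfolding L_def using that r_lim by (intro tendsto_intros) auto
  \<comment> \<open>The integrand is nonnegative by \<open>upper\<close>, and its integral does not
    depend on \<open>n\<close> by the case inside the disc. This is the bound that Fatou
    needs.\<close>
  have integral_n: "(\<integral>\<^sup>+\<theta>. ennreal (ln 2 - L (r n) \<theta>) * indicator {0..1} \<theta> \<partial>lborel)
      = ennreal (ln 2)" for n
  proof -
    have int: "set_integrable lborel {0..1} (\<lambda>\<theta>::real. ln 2 :: real)"
      by (intro borel_integrable_atLeastAtMost' continuous_intros)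
    have "(\<integral>\<^sup>+\<theta>. ennreal (ln 2 - L (r n) \<theta>) * indicator {0..1} \<theta> \<partial>lborel)
        = (\<integral>\<^sup>+\<theta>. ennreal (indicator {0..1} \<theta> *\<^sub>R (ln 2 - L (r n) \<theta>)) \<partial>lborel)"
      by (intro nn_integral_cong) (auto simp: indicator_def)
    also have "\<dots> = ennreal (\<integral>\<theta>. indicator {0..1} \<theta> *\<^sub>R (ln 2 - L (r n) \<theta>) \<partial>lborel)"
    proof (rule nn_integral_eq_integral)
      show "integrable lborel (\<lambda>\<theta>. indicator {0..1} \<theta> *\<^sub>R (ln 2 - L (r n) \<theta>))"
        using set_integral_diff(1)[OF int inside(1)[of n]] by (simp add: set_integrable_def)
      show "AE \<theta> in lborel. 0 \<le> indicator {0..1} \<theta> *\<^sub>R (ln 2 - L (r n) \<theta>)"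
        using upper[of "r n"] nz[of n] r[of n] by (auto simp: indicator_def)
    qed
    also have "(\<integral>\<theta>. indicator {0..1} \<theta> *\<^sub>R (ln 2 - L (r n) \<theta>) \<partial>lborel) = ln 2"
      using set_integral_diff(2)[OF int inside(1)[of n]] inside(2)[of n]
      by (simp add: set_lebesgue_integral_def)
    finally show ?thesis .
  qed
  have "(\<integral>\<^sup>+\<theta>. ennreal (ln 2 - L 1 \<theta>) * indicator {0..1} \<theta> \<partial>lborel)
      \<le> (\<integral>\<^sup>+\<theta>. liminf (\<lambda>n. ennreal (ln 2 - L (r n) \<theta>) * indicator {0..1} \<theta>) \<partial>lborel)"
  proof (rule nn_integral_mono_AE)
    show "AE \<theta> in lborel. ennreal (ln 2 - L 1 \<theta>) * indicator {0..1} \<theta>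
        \<le> liminf (\<lambda>n. ennreal (ln 2 - L (r n) \<theta>) * indicator {0..1} \<theta>)"
      using AE_nz
    proof eventually_elim
      case (elim \<theta>)
      have "(\<lambda>n. ennreal (ln 2 - L (r n) \<theta>)) \<longlonglongrightarrow> ennreal (ln 2 - L 1 \<theta>)"
        by (intro tendsto_ennrealI tendsto_intros lim elim)
      then have "liminf (\<lambda>n. ennreal (ln 2 - L (r n) \<theta>)) = ennreal (ln 2 - L 1 \<theta>)"
        by (intro lim_imp_Liminf) auto
      then show ?case by (simp add: indicator_def)
    qed
  qed
  also have "\<dots> \<le> liminf (\<lambda>n. \<integral>\<^sup>+\<theta>. ennreal (ln 2 - L (r n) \<theta>) * indicator {0..1} \<theta> \<partial>lborel)"
    by (rule nn_integral_liminf) measurable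
  also have "\<dots> = ennreal (ln 2)"
    unfolding integral_n by (simp add: Liminf_const)
  finally have fin: "(\<integral>\<^sup>+\<theta>. ennreal (ln 2 - L 1 \<theta>) * indicator {0..1} \<theta> \<partial>lborel) < \<infinity>"
    by (rule le_less_trans) simp
  have "integrable lborel (\<lambda>\<theta>. indicator {0..1} \<theta> *\<^sub>R (ln 2 - L 1 \<theta>))"
  proof (rule integrableI_nonneg)
    show "AE \<theta> in lborel. 0 \<le> indicator {0..1} \<theta> *\<^sub>R (ln 2 - L 1 \<theta>)"
      using AE_nz by eventually_elim (use upper[of 1] in \<open>auto simp: indicator_def\<close>)
    have "(\<integral>\<^sup>+\<theta>. ennreal (indicator {0..1} \<theta> *\<^sub>R (ln 2 - L 1 \<theta>)) \<partial>lborel)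
        = (\<integral>\<^sup>+\<theta>. ennreal (ln 2 - L 1 \<theta>) * indicator {0..1} \<theta> \<partial>lborel)"
      by (intro nn_integral_cong) (auto simp: indicator_def)
    then show "(\<integral>\<^sup>+\<theta>. ennreal (indicator {0..1} \<theta> *\<^sub>R (ln 2 - L 1 \<theta>)) \<partial>lborel) < \<infinity>"
      using fin by simp
  qed measurable
  then have int_diff: "set_integrable lborel {0..1} (\<lambda>\<theta>. ln 2 - L 1 \<theta>)"
    by (simp only: set_integrable_def)
  have int_const: "set_integrable lborel {0..1} (\<lambda>\<theta>::real. ln 2 :: real)"
    by (intro borel_integrable_atLeastAtMost' continuous_intros)
  have int1: "set_integrable lborel {0..1} (L 1)"
    using set_integral_diff(1)[OF int_const int_diff] by simp
  then show "set_integrable lborel {0..1} (\<lambda>\<theta>. ln (cmod (1 - v * circ \<theta>)))"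
    by (simp add: L_def[abs_def])
  \<comment> \<open>\<open>upper\<close> and \<open>lower\<close> bound \<open>L (r n)\<close> by
    \<open>2 ln 2 + |L 1|\<close>, which is integrable by \<open>int1\<close>.\<close>
  have "(\<lambda>n. \<integral>\<theta>. indicator {0..1} \<theta> *\<^sub>R L (r n) \<theta> \<partial>lborel)
      \<longlonglongrightarrow> (\<integral>\<theta>. indicator {0..1} \<theta> *\<^sub>R L 1 \<theta> \<partial>lborel)"
  proof (rule integral_dominated_convergence[where w="\<lambda>\<theta>. indicator {0..1} \<theta> *\<^sub>R (2 * ln 2
      + \<bar>L 1 \<theta>\<bar>)"])
    have "set_integrable lborel {0..1} (\<lambda>\<theta>::real. 2 * ln 2 :: real)"
      by (intro borel_integrable_atLeastAtMost' continuous_intros)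
    then show "integrable lborel (\<lambda>\<theta>. indicator {0..1} \<theta> *\<^sub>R (2 * ln 2 + \<bar>L 1 \<theta>\<bar>))"
      using set_integral_add(1)[OF _ set_integrable_abs[OF int1]] by (simp add: set_integrable_def)
    show "AE \<theta> in lborel. (\<lambda>n. indicator {0..1} \<theta> *\<^sub>R L (r n) \<theta>) \<longlonglongrightarrow> indicator {0..1} \<theta> *\<^sub>R L 1 \<theta>"
      using AE_nz by eventually_elim (intro tendsto_intros lim)
    show "AE \<theta> in lborel. norm (indicator {0..1} \<theta> *\<^sub>R L (r n) \<theta>)
        \<le> indicator {0..1} \<theta> *\<^sub>R (2 * ln 2 + \<bar>L 1 \<theta>\<bar>)" for n
      using AE_nz
    proof eventually_elim
      case (elim \<theta>)
      have "0 < ln (2::real)" by simp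
      moreover have "L (r n) \<theta> \<le> ln 2" using upper[of "r n" \<theta>] nz r[of n] by simp
      moreover have "L 1 \<theta> - ln 2 \<le> L (r n) \<theta>" by (rule lower[OF elim])
      ultimately have "\<bar>L (r n) \<theta>\<bar> \<le> 2 * ln 2 + \<bar>L 1 \<theta>\<bar>" by linarith
      then show ?case by (simp add: indicator_def)
    qed
  qed measurable
  then have "(\<lambda>n. 0) \<longlonglongrightarrow> (\<integral>\<theta>. indicator {0..1} \<theta> *\<^sub>R L 1 \<theta> \<partial>lborel)"
    using inside(2) by (simp add: set_lebesgue_integral_def)
  then have "(\<integral>\<theta>. indicator {0..1} \<theta> *\<^sub>R L 1 \<theta> \<partial>lborel) = 0"
    using LIMSEQ_unique tendsto_const by blast
  then show "(\<integral>\<theta>\<in>{0..1}. ln (cmod (1 - v * circ \<theta>)) \<partial>lborel) = 0"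
    by (simp add: set_lebesgue_integral_def L_def)
qed

text \<open>Reduction to \<open>1 - v z\<close> with \<open>|v| \<le> 1\<close>. If
  \<open>|w| \<le> 1\<close>, then \<open>|z - w| = |1 - cnj w z|\<close> on the circle; otherwise
  the factor \<open>|w|\<close> is pulled out and supplies the logarithm. At \<open>w = 0\<close>
  the convention \<open>ln 0 = 0\<close> gives the right value.\<close>

lemma jensen_linear:
  shows "set_integrable lborel {0..1} (\<lambda>\<theta>. ln (cmod (circ \<theta> - w)))"
    and "(\<integral>\<theta>\<in>{0..1}. ln (cmod (circ \<theta> - w)) \<partial>lborel) = log_plus (cmod w)"
proof -
  have "set_integrable lborel {0..1} (\<lambda>\<theta>. ln (cmod (circ \<theta> - w))) \<and>
    (\<integral>\<theta>\<in>{0..1}. ln (cmod (circ \<theta> - w)) \<partial>lborel) = log_plus (cmod w)"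
  proof (cases "cmod w \<le> 1")
    case True
    have "cmod (circ \<theta> - w) = cmod (1 - cnj w * circ \<theta>)" for \<theta>
    proof -
      have "circ \<theta> * cnj (circ \<theta>) = 1"
        using complex_norm_square[of "circ \<theta>"] by simp
      then have "circ \<theta> - w = circ \<theta> * cnj (1 - cnj w * circ \<theta>)"
        by (simp add: algebra_simps)
      then show ?thesis by (simp only: norm_mult complex_mod_cnj norm_circ mult_1)
    qed
    moreover have "log_plus (cmod w) = 0"
    proof (cases "w = 0")
      case False
      then have "ln (cmod w) \<le> 0" using True by simp
      then show ?thesis by (simp add: log_plus_def)
    qed (simp add: log_plus_def)
    ultimately show ?thesis
      using True jensen_inside[of "cnj w"] jensen_boundary[of "cnj w"]
      by (cases "cmod w = 1") (auto intro!: borel_integrable_atLeastAtMost')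
  next
    case False
    define v where "v = inverse w"
    have "cmod v = inverse (cmod w)" by (simp add: v_def norm_inverse)
    moreover have "1 < cmod w" using False by simp
    ultimately have w: "w \<noteq> 0" "cmod v < 1" by (auto simp: inverse_less_1_iff)
    have "cmod (circ \<theta> - w) = cmod w * cmod (1 - v * circ \<theta>)" for \<theta>
    proof -
      have "circ \<theta> - w = - (w * (1 - v * circ \<theta>))" using w by (simp add: v_def field_simps)
      then show ?thesis by (simp add: norm_mult del: minus_mult_right)
    qed
    moreover have "1 - v * circ \<theta> \<noteq> 0" for \<theta>
    proof
      assume "1 - v * circ \<theta> = 0"
      then have "cmod (v * circ \<theta>) = 1" by simp
      then show False using w by (simp add: norm_mult)
    qed
    ultimately have eq: "ln (cmod (circ \<theta> - w)) = ln (cmod w) + ln (cmod (1 - v * circ \<theta>))" for \<theta>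
      using w by (simp add: ln_mult)
    have int: "set_integrable lborel {0..1} (\<lambda>\<theta>::real. ln (cmod w))"
      by (intro borel_integrable_atLeastAtMost' continuous_intros)
    note inside = borel_integrable_atLeastAtMost'[OF jensen_inside(1)[OF w(2)]]
        jensen_inside(2)[OF w(2)]
    have "0 < ln (cmod w)" using False by (simp only: not_le ln_gt_zero)
    then show ?thesis
      unfolding eq using set_integral_add[OF int inside(1)] inside(2)
      by (simp add: log_plus_def set_lebesgue_integral_def)
  qed
  then show "set_integrable lborel {0..1} (\<lambda>\<theta>. ln (cmod (circ \<theta> - w)))"
    "(\<integral>\<theta>\<in>{0..1}. ln (cmod (circ \<theta> - w)) \<partial>lborel) = log_plus (cmod w)" by auto
qed

section \<open>Reduction to integrals over the circle\<close>

text \<open>The mean \<open>H(b, c)\<close> of the introductory text, with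
  \<open>t = 2 pi \<theta>\<close>.\<close>

definition cos_integral :: "real \<Rightarrow> real \<Rightarrow> real" where
  "cos_integral b c = integral {0..1} (\<lambda>\<theta>. arcosh_plus (b * cos (2 * pi * \<theta>) + c))"

lemma cos_integrand_continuous: "continuous_on {0..1} (\<lambda>\<theta>. arcosh_plus (b * cos (2 * pi * \<theta>) + c))"
  by (intro continuous_intros)

lemma cos_integral_nonneg: "0 \<le> cos_integral b c"
  unfolding cos_integral_def
  by (intro integral_nonneg integrable_continuous_interval cos_integrand_continuous
      arcosh_plus_nonneg)

text \<open>The roots of \<open>y\<^sup>2 + t y + 1\<close> have product 1. For
  \<open>t \<ge> 2\<close> this one has modulus \<open>exp (arcosh (t / 2))\<close>, for
  \<open>|t| < 2\<close> it has modulus 1, and for \<open>t \<le> -2\<close> modulus at most 1, so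
  that both sides vanish.\<close>

lemma log_plus_larger_root:
  fixes t :: real
  shows "log_plus (cmod ((- of_real t - csqrt ((of_real t)\<^sup>2 - 4)) / 2)) = arcosh_plus (t / 2)"
proof -
  have radicand: "(complex_of_real t)\<^sup>2 - 4 = of_real (t\<^sup>2 - 4)" by simp
  show ?thesis
  proof (cases "t\<^sup>2 < 4")
    case True
    define y where "y = (- of_real t - csqrt ((of_real t)\<^sup>2 - 4)) / 2"
    have "csqrt ((of_real t)\<^sup>2 - 4) = \<i> * sqrt (4 - t\<^sup>2)"
      unfolding radicand using True by (subst csqrt_of_real_nonpos) auto
    then have "y = Complex (- t / 2) (- sqrt (4 - t\<^sup>2) / 2)"
      by (simp add: y_def complex_eq_iff)
    then have "cmod y = 1"
      using True by (simp add: cmod_def power_divide add_divide_distrib[symmetric])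
    moreover have "\<bar>t\<bar> < 2"
      using True abs_square_less_1[of "t / 2"] by (simp add: power_divide)
    ultimately show ?thesis
      by (simp add: y_def log_plus_def arcosh_plus_eq_0)
  next
    case False
    then have t2: "4 \<le> t\<^sup>2" by simp
    define s where "s = sqrt (t\<^sup>2 - 4)"
    have s: "0 \<le> s" "s\<^sup>2 = t\<^sup>2 - 4" using t2 by (auto simp: s_def)
    have "csqrt ((of_real t)\<^sup>2 - 4) = of_real s"
      unfolding radicand s_def using t2 by (intro csqrt_of_real) simp
    then have "(- of_real t - csqrt ((of_real t)\<^sup>2 - 4)) / 2 = complex_of_real (- (t + s) / 2)"
      by simp
    then have mod: "cmod ((- of_real t - csqrt ((of_real t)\<^sup>2 - 4)) / 2) = \<bar>t + s\<bar> / 2"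
      by (simp only: norm_of_real) simp
    have "2 \<le> \<bar>t\<bar>"
      using t2 abs_le_square_iff[of 2 t] by simp
    then consider "2 \<le> t" | "t \<le> -2" by linarith
    then show ?thesis
    proof cases
      case 1
      have "s / 2 = sqrt ((t / 2)\<^sup>2 - 1)"
        using s by (intro real_sqrt_unique[symmetric]) (auto simp: power_divide field_simps)
      then have "arcosh_plus (t / 2) = ln ((t + s) / 2)"
        using 1 by (simp add: arcosh_plus_eq arcosh_real_def add_divide_distrib)
      moreover have "0 \<le> ln ((t + s) / 2)" using 1 s by simp
      ultimately show ?thesis
        unfolding mod using 1 s by (simp add: log_plus_def)
    next
      case 2
      have "s\<^sup>2 < (- t)\<^sup>2" using s by simp
      then have "s < - t" by (rule power2_less_imp_less) (use 2 in simp)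
      moreover have "(- t - 2)\<^sup>2 \<le> s\<^sup>2"
        using 2 s by (simp add: power2_eq_square algebra_simps)
      then have "- t - 2 \<le> s" by (rule power2_le_imp_le) (rule s)
      ultimately have "ln (\<bar>t + s\<bar> / 2) \<le> 0" by (simp add: ln_le_zero_iff)
      then show ?thesis
        unfolding mod using 2 by (simp add: log_plus_def arcosh_plus_eq_0)
    qed
  qed
qed

lemma log_plus_y_minus:
  "log_plus (cmod (y_minus a c (circ \<theta>))) = arcosh_plus (a * cos (2 * pi * \<theta>) + c / 2)"
proof -
  have "of_real a * (circ \<theta> + 1 / circ \<theta>) + of_real c
      = complex_of_real (2 * a * cos (2 * pi * \<theta>) + c)"
    unfolding circ_plus_inverse by simp
  then show ?thesis
    unfolding y_minus_def by (simp only: log_plus_larger_root) (simp add: add_divide_distrib)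
qed

text \<open>Negating \<open>a\<close> and \<open>c\<close> keeps the radicand and turns one root
  into the negative of the other.\<close>

lemma log_plus_y_plus:
  "log_plus (cmod (y_plus a c (circ \<theta>))) = arcosh_plus (- a * cos (2 * pi * \<theta>) + - c / 2)"
proof -
  define t where "t = of_real a * (circ \<theta> + 1 / circ \<theta>) + of_real c"
  have "y_plus a c (circ \<theta>) = - y_minus (- a) (- c) (circ \<theta>)"
  proof -
    have minus_t: "of_real (- a) * (circ \<theta> + 1 / circ \<theta>) + of_real (- c) = - t"
      by (simp add: t_def)
    show ?thesis
      unfolding y_plus_def y_minus_def minus_t t_def[symmetric] by (simp add: field_simps)
  qed
  then show ?thesis by (simp only: norm_minus_cancel log_plus_y_minus)
qed

lemma contour_integral_circle:
  assumes "continuous_on {0..1} f" and "\<And>\<theta>. F (circ \<theta>) = f \<theta>"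
  shows "1 / (2 * of_real pi * \<i>) * contour_integral (circlepath 0 1) (\<lambda>x. of_real (F x) / x)
    = of_real (integral {0..1} f)"
proof -
  have "((\<lambda>\<theta>. complex_of_real (f \<theta>)) has_integral of_real (integral {0..1} f)) {0..1}"
    by (intro has_integral_of_real integrable_integral integrable_continuous_interval assms)
  then have "((\<lambda>\<theta>. (2 * of_real pi * \<i>) * complex_of_real (f \<theta>)) has_integral
      (2 * of_real pi * \<i>) * of_real (integral {0..1} f)) {0..1}"
    by (rule has_integral_mult_right)
  then have "((\<lambda>x. of_real (F x) / x)
      has_contour_integral (2 * of_real pi * \<i>) * of_real (integral {0..1} f)) (circlepath 0 1)"
    by (simp add: has_contour_integral circlepath_circ vector_derivative_circ assms(2) mult_ac)
  then show ?thesis by (simp add: contour_integral_unique)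
qed

lemma half_mahler_minus_eq: "half_mahler_minus a c = of_real (cos_integral a (c / 2))"
  unfolding half_mahler_minus_def cos_integral_def
  by (rule contour_integral_circle[OF cos_integrand_continuous])
     (rule log_plus_y_minus)

lemma half_mahler_plus_eq: "half_mahler_plus a c = of_real (cos_integral (- a) (- c / 2))"
  unfolding half_mahler_plus_def cos_integral_def
  by (rule contour_integral_circle[OF cos_integrand_continuous])
     (rule log_plus_y_plus)

lemma LBINT_01: "(LBINT \<theta>=0..1. f \<theta>) = (\<integral>\<theta>\<in>{0..1}. f \<theta> \<partial>lborel)" for f :: "real \<Rightarrow> real"
  using interval_integral_Icc[of 0 1 f] by (simp add: zero_ereal_def one_ereal_def)

text \<open>Jensen's formula in the inner variable leaves \<open>log_plus\<close> of the two roots,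
  of which \<open>k > 0\<close> silences one.\<close>

lemma mahler_measure_eq:
  assumes "0 < k"
  shows "mahler_measure (P_poly 1 k) = cos_integral 1 (k / 2)"
proof -
  have inner: "(LBINT \<theta>\<^sub>1=0..1. ln (cmod (laurent2_eval (P_poly 1 k) (circ \<theta>\<^sub>1) (circ \<theta>\<^sub>2))))
      = arcosh_plus (1 * cos (2 * pi * \<theta>\<^sub>2) + k / 2)" for \<theta>\<^sub>2
  proof -
    let ?y = "y_plus 1 k (circ \<theta>\<^sub>2)" and ?z = "y_minus 1 k (circ \<theta>\<^sub>2)"
    have "(LBINT \<theta>\<^sub>1=0..1. ln (cmod (laurent2_eval (P_poly 1 k) (circ \<theta>\<^sub>1) (circ \<theta>\<^sub>2))))
      = (\<integral>\<theta>\<in>{0..1}. (ln (cmod (circ \<theta> - ?y)) + ln (cmod (circ \<theta> - ?z))) \<partial>lborel)"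
      unfolding LBINT_01
    proof (rule set_lebesgue_integral_cong_AE)
      have "AE \<theta> in lborel. ln (cmod (laurent2_eval (P_poly 1 k) (circ \<theta>) (circ \<theta>\<^sub>2)))
          = ln (cmod (circ \<theta> - ?y)) + ln (cmod (circ \<theta> - ?z))"
        using AE_circ_neq[of ?y] AE_circ_neq[of ?z]
      proof eventually_elim
        case (elim \<theta>)
        \<comment> \<open>For \<open>a = 1\<close> the polynomial is symmetric, so the factorization
          in \<open>y\<close> serves for the inner variable \<open>x\<close>.\<close>
        have "laurent2_eval (P_poly 1 k) (circ \<theta>) (circ \<theta>\<^sub>2)
            = laurent2_eval (P_poly 1 k) (circ \<theta>\<^sub>2) (circ \<theta>)"
          by (simp add: laurent2_eval_P_poly)
        then have "circ \<theta> * laurent2_eval (P_poly 1 k) (circ \<theta>) (circ \<theta>\<^sub>2)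
            = (circ \<theta> - ?y) * (circ \<theta> - ?z)"
          using P_poly_factorization[of "circ \<theta>" 1 k "circ \<theta>\<^sub>2"] by simp
        then have "cmod (laurent2_eval (P_poly 1 k) (circ \<theta>) (circ \<theta>\<^sub>2))
            = cmod (circ \<theta> - ?y) * cmod (circ \<theta> - ?z)"
          by (metis mult_1 norm_circ norm_mult)
        then show ?case using elim by (simp add: ln_mult)
      qed
      then show "AE \<theta>\<in>{0..1} in lborel. ln (cmod (laurent2_eval (P_poly 1 k) (circ \<theta>) (circ \<theta>\<^sub>2)))
          = ln (cmod (circ \<theta> - ?y)) + ln (cmod (circ \<theta> - ?z))"
        by eventually_elim simp
    qed (unfold laurent2_eval_P_poly, measurable)
    also have "\<dots> = log_plus (cmod ?y) + log_plus (cmod ?z)"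
      by (simp add: set_integral_add jensen_linear)
    also have "\<dots> = arcosh_plus (- cos (2 * pi * \<theta>\<^sub>2) - k / 2)
        + arcosh_plus (1 * cos (2 * pi * \<theta>\<^sub>2) + k / 2)"
      by (simp add: log_plus_y_plus log_plus_y_minus)
    also have "arcosh_plus (- cos (2 * pi * \<theta>\<^sub>2) - k / 2) = 0"
      using assms cos_ge_minus_one[of "2 * pi * \<theta>\<^sub>2"] by (intro arcosh_plus_eq_0) linarith
    finally show ?thesis by simp
  qed
  have "mahler_measure (P_poly 1 k)
      = (\<integral>\<theta>\<in>{0..1}. arcosh_plus (1 * cos (2 * pi * \<theta>) + k / 2) \<partial>lborel)"
    unfolding mahler_measure_def circ_def[symmetric] inner LBINT_01 ..
  also have "\<dots> = cos_integral 1 (k / 2)"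
    unfolding cos_integral_def
    by (intro set_borel_integral_eq_integral borel_integrable_atLeastAtMost'
        cos_integrand_continuous)
  finally show ?thesis .
qed

text \<open>Over one period the cosine covers \<open>[-1, 1]\<close> twice, and on each half the
  Jacobian \<open>2 pi |sin|\<close> cancels the weight.\<close>

lemma arcsine_law:
  assumes [measurable]: "F \<in> borel_measurable borel"
  shows "band_integral (-1) 1 (\<lambda>u. F u / sqrt (1 - u\<^sup>2))
      = ennreal pi * band_integral 0 1 (\<lambda>\<theta>. F (cos (2 * pi * \<theta>)))"
proof -
  define f where "f u = F u / sqrt (1 - u\<^sup>2)" for u
  define h where "h \<theta> = F (cos (2 * pi * \<theta>))" for \<theta>
  have [measurable]: "f \<in> borel_measurable borel" "h \<in> borel_measurable borel"
    unfolding f_def h_def by measurable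
  have sqrt_sin: "sqrt (1 - (cos x)\<^sup>2) = \<bar>sin x\<bar>" for x :: real
    by (simp add: sin_squared_eq[symmetric])
  have neg: "sin (2 * pi * \<theta>) < 0" if "1/2 < \<theta>" "\<theta> < 1" for \<theta>
    using that sin_lt_zero[of "2 * pi * \<theta>"] by simp
  have pos: "0 < sin (2 * pi * \<theta>)" if "0 < \<theta>" "\<theta> < 1/2" for \<theta>
    using that by (intro sin_gt_zero) auto
  have upper: "band_integral (cos (2 * pi * (1/2))) (cos (2 * pi * 1)) f
      = band_integral (1/2) 1 (\<lambda>\<theta>. (2 * pi) * h \<theta>)"
  proof (rule band_integral_subst[where g="\<lambda>\<theta>. cos (2 * pi * \<theta>)" and g'="\<lambda>\<theta>.
      - (2 * pi) * sin (2 * pi * \<theta>)"])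
    fix x :: real assume "x \<in> {1/2..1}"
    then have "sin (2 * pi * x) \<le> 0"
      using sin_le_zero[of "2 * pi * x"] by (cases "x = 1") auto
    then show "0 \<le> - (2 * pi) * sin (2 * pi * x)" by (simp add: mult_nonneg_nonpos)
  next
    fix x :: real assume "1/2 < x" "x < 1"
    then show "f (cos (2 * pi * x)) * (- (2 * pi) * sin (2 * pi * x)) = 2 * pi * h x"
      using neg[of x] by (simp add: f_def h_def sqrt_sin)
  qed (auto intro!: derivative_eq_intros continuous_intros)
  \<comment> \<open>The cosine falls on the first half, so \<open>- cos\<close> is substituted;
    \<open>reflect\<close> undoes the change of sign.\<close>
  have lower: "band_integral (- cos (2 * pi * 0)) (- cos (2 * pi * (1/2))) (\<lambda>u. f (- u))
      = band_integral 0 (1/2) (\<lambda>\<theta>. (2 * pi) * h \<theta>)"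
  proof (rule band_integral_subst[where g="\<lambda>\<theta>.
      - cos (2 * pi * \<theta>)" and g'="\<lambda>\<theta>. 2 * pi * sin (2 * pi * \<theta>)"])
    fix x :: real assume "x \<in> {0..1/2}"
    then show "0 \<le> 2 * pi * sin (2 * pi * x)"
      using sin_ge_zero[of "2 * pi * x"] by simp
  next
    fix x :: real assume "0 < x" "x < 1/2"
    then show "f (- (- cos (2 * pi * x))) * (2 * pi * sin (2 * pi * x)) = 2 * pi * h x"
      using pos[of x] by (simp add: f_def h_def sqrt_sin)
  qed (auto intro!: derivative_eq_intros continuous_intros)
  have reflect: "band_integral (-1) 1 (\<lambda>u. f (- u)) = band_integral (-1) 1 f"
    using band_integral_reflect[of f "-1" 1] by (simp only: minus_minus) measurable
  have "ennreal (2 * pi) * band_integral 0 1 h = band_integral 0 1 (\<lambda>\<theta>. (2 * pi) * h \<theta>)"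
    by (rule band_integral_cmult[symmetric]) auto
  also have "\<dots> = band_integral 0 (1/2) (\<lambda>\<theta>. (2 * pi) * h \<theta>)
      + band_integral (1/2) 1 (\<lambda>\<theta>. (2 * pi) * h \<theta>)"
    by (rule band_integral_split) auto
  also have "\<dots> = band_integral (-1) 1 f + band_integral (-1) 1 f"
    unfolding upper[symmetric] lower[symmetric] using reflect by simp
  also have "\<dots> = 2 * band_integral (-1) 1 f"
    by (rule mult_2[symmetric])
  finally have "2 * band_integral (-1) 1 f = 2 * (ennreal pi * band_integral 0 1 h)"
    by (simp add: ennreal_mult mult.assoc)
  then have "band_integral (-1) 1 f = ennreal pi * band_integral 0 1 h"
    by (simp add: ennreal_mult_cancel_left)
  then show ?thesis by (simp add: f_def[abs_def] h_def[abs_def])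
qed

lemma band_integral_arcosh_plus:
  "band_integral (-1) 1 (\<lambda>u. arcosh_plus (b * u + c) / sqrt (1 - u\<^sup>2))
      = ennreal (pi * cos_integral b c)"
proof -
  have "band_integral 0 1 (\<lambda>\<theta>. arcosh_plus (b * cos (2 * pi * \<theta>) + c)) = ennreal (cos_integral b c)"
    unfolding band_integral_def cos_integral_def
    by (intro nn_integral_has_integral_lebesgue' integrable_integral integrable_continuous_interval
        cos_integrand_continuous arcosh_plus_nonneg)
  then show ?thesis
    using arcsine_law[of "\<lambda>u. arcosh_plus (b * u + c)"]
    by (simp add: ennreal_mult cos_integral_nonneg)
qed

text \<open>Reflecting \<open>u\<close> preserves the weight. This brings
  \<open>half_mahler_plus_eq\<close>, stated with slope \<open>- a\<close>, to slope
  \<open>a\<close>.\<close>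

lemma cos_integral_minus: "cos_integral (- b) c = cos_integral b c"
proof -
  have "ennreal (pi * cos_integral (- b) c) = ennreal (pi * cos_integral b c)"
    unfolding band_integral_arcosh_plus[symmetric]
    by (subst band_integral_reflect) simp_all
  then show ?thesis by (simp add: cos_integral_nonneg)
qed

section \<open>The identity\<close>

context band_family
begin

text \<open>The domain \<open>{R s..1}\<close> varies with \<open>s\<close>; written as a condition
  on the pair of \<open>s\<close> and \<open>u\<close>, it is jointly measurable.\<close>

lemma measurable_band [measurable]:
  "(\<lambda>s. band_integral (R s) 1 (\<lambda>u. dg s u / (sqrt ((g s u)\<^sup>2 - 1) * sqrt (1 - u\<^sup>2))))
      \<in> borel_measurable borel"
proof -
  have "band_integral (R s) 1 (\<lambda>u. dg s u / (sqrt ((g s u)\<^sup>2 - 1) * sqrt (1 - u\<^sup>2)))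
      = (\<integral>\<^sup>+u. (if R s \<le> u \<and> u
      \<le> 1 then ennreal (dg s u / (sqrt ((g s u)\<^sup>2 - 1) * sqrt (1 - u\<^sup>2))) else 0) \<partial>lborel)" for s
    unfolding band_integral_def by (intro nn_integral_cong) auto
  moreover have "(\<lambda>s. \<integral>\<^sup>+u. (if R s \<le> u \<and> u
      \<le> 1 then ennreal (dg s u / (sqrt ((g s u)\<^sup>2 - 1) * sqrt (1 - u\<^sup>2))) else 0) \<partial>lborel)
      \<in> borel_measurable borel"
    unfolding dg_def g_def by measurable
  ultimately show ?thesis by presburger
qed

end

section \<open>The three families in the parameter \<open>s\<close>\<close>

definition p_of :: "real \<Rightarrow> real" where "p_of s = sqrt (4 - s)"
definition w_of :: "real \<Rightarrow> real" where "w_of s = sqrt (4 + s)"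

lemma p_of_sq: "s < 4 \<Longrightarrow> (p_of s)\<^sup>2 = 4 - s"
  by (simp add: p_of_def)

lemma w_of_sq: "0 \<le> s \<Longrightarrow> (w_of s)\<^sup>2 = 4 + s"
  by (simp add: w_of_def)

lemma circle_point_of:
  assumes "0 < s" "s < 4"
  shows "circle_point (p_of s) (w_of s)"
proof
  show "0 < p_of s" "0 < w_of s" using assms by (auto simp: p_of_def w_of_def)
  have "sqrt (4 - s) < sqrt (2\<^sup>2)" using assms by (intro real_sqrt_less_mono) simp
  then show "p_of s < 2" by (simp add: p_of_def)
  show "(w_of s)\<^sup>2 = 8 - (p_of s)\<^sup>2" using assms by (simp add: p_of_sq w_of_sq)
qed

text \<open>Here \<open>g s u = u + s / 2\<close>: the family of \<open>P_poly 1 s\<close>.\<close>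

lemma family_unit:
  assumes "0 < k" "k < 4"
  shows "band_family (\<lambda>_. 1) (\<lambda>s. 1 - s / 2) (\<lambda>_. 0) (\<lambda>_. - 1 / 2) k"
  by standard (use assms in \<open>auto intro!: derivative_eq_intros continuous_intros\<close>)

text \<open>The derivative of \<open>lin_root\<close> along the family, factored so that its sign is
  visible for both \<open>\<sigma>\<close>.\<close>

definition root_deriv :: "real \<Rightarrow> real \<Rightarrow> real" where
  "root_deriv \<sigma> s = (\<sigma> * p_of s - 4) * (p_of s + 2 * \<sigma>)\<^sup>2 / (4 * p_of s * w_of s ^ 3)"

lemma family_circle:
  assumes k: "0 < k" "k < 4" and \<sigma>: "\<sigma> = 1 \<or> \<sigma> = -1"
  shows "band_family (\<lambda>s. w_of s / p_of s) (\<lambda>s. (p_of s - \<sigma> * s / 2) / w_of s)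
    (\<lambda>s. 4 / (w_of s * p_of s ^ 3)) (root_deriv \<sigma>) k"
proof
  show "(\<lambda>s. w_of s / p_of s) \<in> borel_measurable borel" "(\<lambda>s. (p_of s - \<sigma> * s / 2) / w_of s)
      \<in> borel_measurable borel"
    "(\<lambda>s. 4 / (w_of s * p_of s ^ 3)) \<in> borel_measurable borel" "root_deriv \<sigma>
        \<in> borel_measurable borel"
    unfolding root_deriv_def p_of_def w_of_def by measurable
  have pos: "0 < p_of s" "0 < w_of s" if "0 \<le> s" "s \<le> k" for s
    using that k by (auto simp: p_of_def w_of_def)
  show "continuous_on {0..k} (\<lambda>s. w_of s / p_of s)"
    "continuous_on {0..k} (\<lambda>s. (p_of s - \<sigma> * s / 2) / w_of s)"
    using k unfolding p_of_def w_of_def by (auto intro!: continuous_intros)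
  show "0 < w_of s / p_of s" if "0 \<le> s" "s \<le> k" for s
    using pos[OF that] by simp
  show "(p_of 0 - \<sigma> * 0 / 2) / w_of 0 = 1" by (simp add: p_of_def w_of_def)
  fix s assume s: "0 < s" "s < k"
  then interpret circle_point "p_of s" "w_of s"
    using k by (intro circle_point_of) auto
  define P W where "P = p_of s" and "W = w_of s"
  have s_eq: "s = 4 - P\<^sup>2" and W_sq: "W\<^sup>2 = 8 - P\<^sup>2" and PW0: "0 < P" "P < 2" "0 < W"
    using p_of_sq[of s] s k P W PW by (auto simp: P_def W_def)
  have dP: "(p_of has_real_derivative - 1 / (2 * P)) (at s)"
    unfolding p_of_def[abs_def] P_def using s k
    by (auto intro!: derivative_eq_intros simp: field_simps)
  have dW: "(w_of has_real_derivative 1 / (2 * W)) (at s)"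
    unfolding w_of_def[abs_def] W_def using s k
    by (auto intro!: derivative_eq_intros simp: field_simps)
  have "((\<lambda>s. w_of s / p_of s)
      has_real_derivative (1 / (2 * W) * P - W * (- 1 / (2 * P))) / (P * P)) (at s)"
    using DERIV_divide[OF dW dP] PW0 by (simp add: P_def W_def)
  also have "(1 / (2 * W) * P - W * (- 1 / (2 * P))) / (P * P) = (P\<^sup>2 + W\<^sup>2) / (2 * W * P ^ 3)"
    using PW0 by (simp add: power2_eq_square power3_eq_cube field_simps)
  also have "\<dots> = 4 / (W * P ^ 3)" using W_sq by simp
  finally show "((\<lambda>s. w_of s / p_of s) has_real_derivative 4 / (w_of s * p_of s ^ 3)) (at s)"
    by (simp add: P_def W_def)
  have "((\<lambda>s. p_of s - \<sigma> * s / 2) has_real_derivative - 1 / (2 * P) - \<sigma> / 2) (at s)"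
    by (auto intro!: derivative_eq_intros dP)
  from DERIV_divide[OF this dW]
  have "((\<lambda>s. (p_of s - \<sigma> * s / 2) / w_of s) has_real_derivative
      ((- 1 / (2 * P) - \<sigma> / 2) * W - (P - \<sigma> * s / 2) * (1 / (2 * W))) / (W * W)) (at s)"
    using PW0 by (simp add: P_def W_def)
  also have "((- 1 / (2 * P) - \<sigma> / 2) * W - (P - \<sigma> * s / 2) * (1 / (2 * W))) / (W * W)
      = (- 2 * (1 + \<sigma> * P) * W\<^sup>2 - 2 * P * (P - \<sigma> * s / 2)) / (4 * P * W ^ 3)"
    using PW0 by (simp add: power2_eq_square power3_eq_cube field_simps)
  \<comment> \<open>The factors of \<open>deform_coeff_nonneg\<close> return, since at
    \<open>u = R s\<close> the derivative of the affine function is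
    \<open>- \<alpha> R'\<close>.\<close>
  also have "- 2 * (1 + \<sigma> * P) * W\<^sup>2 - 2 * P * (P - \<sigma> * s / 2) = (\<sigma> * P - 4) * (P + 2 * \<sigma>)\<^sup>2"
    unfolding W_sq s_eq using \<sigma> by (auto simp: power2_eq_square field_simps)
  finally show "((\<lambda>s. (p_of s - \<sigma> * s / 2) / w_of s) has_real_derivative root_deriv \<sigma> s) (at s)"
    by (simp add: root_deriv_def P_def W_def)
  show "0 \<le> 4 / (w_of s * p_of s ^ 3)" using P W by simp
  \<comment> \<open>For \<open>\<sigma> = -1\<close> strictness rests on \<open>P < 2\<close>, that
    is on \<open>s > 0\<close>.\<close>
  have "(\<sigma> * P - 4) * (P + 2 * \<sigma>)\<^sup>2 < 0"
    using \<sigma> PW0 by (intro mult_neg_pos) auto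
  then show "root_deriv \<sigma> s < 0"
    using P W by (simp add: root_deriv_def P_def divide_neg_pos)
  show "- 1 \<le> (p_of s - \<sigma> * s / 2) / w_of s"
    using lin_root_gt[OF \<sigma>] p_of_sq[of s] s k by (simp add: lin_root_def)
qed (rule k)

theorem theorem2:
  fixes k a c :: real
  assumes "0 < k" and "k < 4"
    and "a = sqrt ((4 + k) / (4 - k))"
    and "c = k / sqrt (4 - k)"
  shows "complex_of_real (mahler_measure (P_poly 1 k)) =
           half_mahler_minus a c - 3 * half_mahler_plus a c"
proof -
  note k = assms(1,2)
  have a_def: "a = w_of k / p_of k" and c_def: "c = k / p_of k"
    using assms by (simp_all add: p_of_def w_of_def real_sqrt_divide)
  interpret unit: band_family "\<lambda>_. 1" "\<lambda>s. 1 - s / 2" "\<lambda>_. 0" "\<lambda>_. - 1 / 2" k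
    by (rule family_unit[OF k])
  \<comment> \<open>The names follow the sign of \<open>\<sigma>\<close>: \<open>minus\<close> is
    the family of \<open>half_mahler_plus\<close>, and \<open>plus\<close> that of
    \<open>half_mahler_minus\<close>.\<close>
  interpret minus: band_family "\<lambda>s. w_of s / p_of s" "\<lambda>s. (p_of s - (-1) * s / 2) / w_of s"
    "\<lambda>s. 4 / (w_of s * p_of s ^ 3)" "root_deriv (-1)" k
    by (rule family_circle[OF k]) simp
  interpret plus: band_family "\<lambda>s. w_of s / p_of s" "\<lambda>s. (p_of s - 1 * s / 2) / w_of s"
    "\<lambda>s. 4 / (w_of s * p_of s ^ 3)" "root_deriv 1" k
    by (rule family_circle[OF k]) simp
  \<comment> \<open>Integrated over \<open>{0..k}\<close>, the functions \<open>A\<close>,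
    \<open>B\<close> and \<open>C\<close> give \<open>pi\<close> times the Mahler measure, the plus
    half and the minus half.\<close>
  define A where "A s = band_integral (1 - s / 2) 1 (\<lambda>u. unit.dg s u / (sqrt ((unit.g s u)\<^sup>2
      - 1) * sqrt (1 - u\<^sup>2)))" for s
  define B where "B s = band_integral ((p_of s
      - (-1) * s / 2) / w_of s) 1 (\<lambda>u. minus.dg s u / (sqrt ((minus.g s u)\<^sup>2 - 1) * sqrt (1
      - u\<^sup>2)))" for s
  define C where "C s = band_integral ((p_of s
      - 1 * s / 2) / w_of s) 1 (\<lambda>u. plus.dg s u / (sqrt ((plus.g s u)\<^sup>2 - 1) * sqrt (1
      - u\<^sup>2)))" for s
  have [measurable]: "A \<in> borel_measurable borel" "B \<in> borel_measurable borel"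
    unfolding A_def[abs_def] B_def[abs_def] by (rule unit.measurable_band minus.measurable_band)+
  have ABC: "A s + 3 * B s = C s" if s: "0 < s" "s < k" for s
  proof -
    interpret circle_point "p_of s" "w_of s"
      using s k by (intro circle_point_of) auto
    have s_eq: "4 - (p_of s)\<^sup>2 = s" using p_of_sq[of s] s k by simp
    have lin: "1 + w_of s / p_of s * (u - (p_of s - \<sigma> * s / 2) / w_of s)
        = lin (p_of s) (w_of s) \<sigma> u" for u \<sigma>
      unfolding lin_def s_eq using P W by (simp add: field_simps)
    have root: "(p_of s - \<sigma> * s / 2) / w_of s = lin_root (p_of s) (w_of s) \<sigma>" for \<sigma>
      by (simp add: lin_root_def s_eq)
    \<comment> \<open>Both sides are affine in \<open>u\<close> with the same slope, so only the
      constant terms need comparing.\<close>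
    have dg: "4 / (w_of s * p_of s ^ 3) * (u - (p_of s - \<sigma> * s / 2) / w_of s)
        - w_of s / p_of s * root_deriv \<sigma> s
        = 4 / (w_of s * p_of s ^ 3) * (u + \<sigma> * w_of s / 4) + \<sigma> / (4 * p_of s)"
      if \<sigma>: "\<sigma> = 1 \<or> \<sigma> = -1" for u \<sigma>
    proof -
      define P' W' where "P' = p_of s" and "W' = w_of s"
      have P': "0 < P'" "0 < W'" "W'\<^sup>2 = 8 - P'\<^sup>2" and s': "s = 4 - P'\<^sup>2"
        using P W PW s_eq by (auto simp: P'_def W'_def)
      have "16 * (P' - \<sigma> * s / 2) + P' * ((\<sigma> * P' - 4) * (P' + 2 * \<sigma>)\<^sup>2)
          = - (\<sigma> * (4 + P'\<^sup>2) * W'\<^sup>2)"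
        unfolding P'(3) s' using \<sigma> by (auto simp: power2_eq_square field_simps)
      moreover have "4 / (W' * P' ^ 3) * ((P' - \<sigma> * s / 2) / W') + W' / P' * ((\<sigma> * P' - 4) * (P'
          + 2 * \<sigma>)\<^sup>2 / (4 * P' * W' ^ 3))
        = (16 * (P' - \<sigma> * s / 2) + P' * ((\<sigma> * P' - 4) * (P' + 2 * \<sigma>)\<^sup>2)) / (4 * P' ^ 3 * W'\<^sup>2)"
        using P'(1,2) by (simp add: divide_simps)
            (simp add: power2_eq_square power3_eq_cube algebra_simps)
      moreover have "- (\<sigma> * (4 + P'\<^sup>2) * W'\<^sup>2) / (4 * P' ^ 3 * W'\<^sup>2)
          = - (4 / (W' * P' ^ 3) * (\<sigma> * W' / 4)) - \<sigma> / (4 * P')"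
        using P'(1,2) by (simp add: divide_simps)
            (simp add: power2_eq_square power3_eq_cube algebra_simps)
      ultimately have "4 / (W' * P' ^ 3) * ((P' - \<sigma> * s / 2) / W') + W' / P' * root_deriv \<sigma> s
        = - (4 / (W' * P' ^ 3) * (\<sigma> * W' / 4)) - \<sigma> / (4 * P')"
        by (simp only: root_deriv_def P'_def[symmetric] W'_def[symmetric])
      then show ?thesis
        unfolding P'_def[symmetric] W'_def[symmetric] right_diff_distrib distrib_left by linarith
    qed
    note lin = lin[unfolded root] and dg = dg[unfolded root]
    have "A s = band_integral (1 - (4 - (p_of s)\<^sup>2) / 2) 1
      (\<lambda>u. (1/2) / (sqrt ((u + (4 - (p_of s)\<^sup>2) / 2)\<^sup>2 - 1) * sqrt (1 - u\<^sup>2)))"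
      unfolding A_def s_eq unit.g_def unit.dg_def by (simp add: algebra_simps)
    moreover have "B s = band_integral (lin_root (p_of s) (w_of s) (-1)) 1 (deform (-1))"
      unfolding B_def minus.g_def minus.dg_def root lin dg[OF disjI2[OF refl]]
      by (intro band_integral_cong) (simp add: deform_def first_kind_def)
    moreover have "C s = band_integral (lin_root (p_of s) (w_of s) 1) 1 (deform 1)"
      unfolding C_def plus.g_def plus.dg_def root lin dg[OF disjI1[OF refl]]
      by (intro band_integral_cong) (simp add: deform_def first_kind_def)
    ultimately show ?thesis using deform_identity by simp
  qed
  have pos: "0 < p_of k" "0 < w_of k" using k by (auto simp: p_of_def w_of_def)
  have "unit.g k u = 1 * u + k / 2" for u
    unfolding unit.g_def by (simp add: field_simps)
  then have "(\<integral>\<^sup>+s. A s * indicator {0..k} s \<partial>lborel) = ennreal (pi * cos_integral 1 (k / 2))"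
    using unit.tonelli band_integral_arcosh_plus[of 1 "k / 2"] by (simp add: A_def)
  moreover have "minus.g k u = a * u + - c / 2" for u
    unfolding minus.g_def a_def c_def using pos by (simp add: field_simps)
  then have "(\<integral>\<^sup>+s. B s * indicator {0..k} s \<partial>lborel) = ennreal (pi * cos_integral a (- c / 2))"
    using minus.tonelli band_integral_arcosh_plus[of a "- c / 2"] by (simp add: B_def)
  moreover have "plus.g k u = a * u + c / 2" for u
    unfolding plus.g_def a_def c_def using pos by (simp add: field_simps)
  then have "(\<integral>\<^sup>+s. C s * indicator {0..k} s \<partial>lborel) = ennreal (pi * cos_integral a (c / 2))"
    using plus.tonelli band_integral_arcosh_plus[of a "c / 2"] by (simp add: C_def)
  moreover have "(\<integral>\<^sup>+s. C s * indicator {0..k} s \<partial>lborel)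
      = (\<integral>\<^sup>+s. A s * indicator {0..k} s + 3 * (B s * indicator {0..k} s) \<partial>lborel)"
  proof (rule nn_integral_cong_AE)
    show "AE s in lborel. C s * indicator {0..k} s
        = A s * indicator {0..k} s + 3 * (B s * indicator {0..k} s)"
      using AE_lborel_singleton[of 0] AE_lborel_singleton[of k]
      by eventually_elim (auto simp: ABC[symmetric] indicator_def)
  qed
  moreover have "\<dots>
      = (\<integral>\<^sup>+s. A s * indicator {0..k} s \<partial>lborel) + 3 * (\<integral>\<^sup>+s. B s * indicator {0..k} s \<partial>lborel)"
    by (simp add: nn_integral_add nn_integral_cmult)
  ultimately have "ennreal (pi * cos_integral a (c / 2))
      = ennreal (pi * cos_integral 1 (k / 2)) + ennreal 3 * ennreal (pi * cos_integral a (- c / 2))"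
    by simp
  also have "\<dots> = ennreal (pi * cos_integral 1 (k / 2) + 3 * (pi * cos_integral a (- c / 2)))"
    by (simp add: cos_integral_nonneg ennreal_mult ennreal_plus)
  \<comment> \<open>All terms are finite and nonnegative, so the equation passes to the reals, where
    the subtraction in the claim is possible.\<close>
  finally have "pi * cos_integral a (c / 2)
      = pi * (cos_integral 1 (k / 2) + 3 * cos_integral a (- c / 2))"
    by (subst (asm) ennreal_inj) (simp_all add: cos_integral_nonneg distrib_left)
  then have "cos_integral 1 (k / 2) = cos_integral a (c / 2) - 3 * cos_integral a (- c / 2)"
    by simp
  then show ?thesis
    using k by (simp add: mahler_measure_eq half_mahler_minus_eq half_mahler_plus_eq cos_integral_minus)
qed

end
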